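(* Let $R=\mathbb{C}[x,y,z]$ and $\mathfrak m=(x,y,z)$. Let $\ell\in R_1\smallsetminus\{0\}$ be a nonzero linear form, let $L\subset R_1$ be a $2$-dimensional linear subspace with $R_1=\langle\ell\rangle\oplus L$, let $v\in(\operatorname{Sym}^3(L)+\ell\cdot L)\smallsetminus\{0\}$, and let \[ I=\big((\ell)+\mathfrak m^2\big)^2+(v)\subset R \] (an ideal of colength $12$). Then $I$ is smoothable, i.e. the point $[I]\in\operatorname{Hilb}^{12}\mathbb{A}^3$ lies in the smoothable component.
   Context: $R_k$ denotes the space of homogeneous polynomials of degree $k$ in $R$ (together with $0$). $\operatorname{Sym}^3(L)\subset R_3$ is the span of all products of three elements of $L$, and $\ell\cdot L=\{\ell m: m\in L\}\subset R_2$. $\operatorname{Hilb}^{d}\mathbb{A}^3$ is the Hilbert scheme of zero-dimensional closed subschemes of length $d$ of $\mathbb{A}^3=\mathbb{A}^3_{\mathbb{C}}$, and $[I]$ denotes the point corresponding to the subscheme defined by the ideal $I$. The smoothable component of $\operatorname{Hilb}^d\mathbb{A}^3$ is the closure of the open subscheme parametrising reduced zero-dimensional closed subschemes of length $d$ (i.e. $d$ distinct points). *)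

theory Defs
  imports "HOL-Analysis.Analysis" "HOL-Library.Poly_Mapping"
begin

section \<open>Complex polynomials in a family of commuting variables\<close>

text \<open>The monoid algebra over \<open>\<complex>\<close> of the exponents \<open>'i \<Rightarrow>\<^sub>0 nat\<close>; the multiplication of
  \<^theory>\<open>HOL-Library.Poly_Mapping\<close> is the convolution product.\<close>

type_synonym 'i cpoly = "('i \<Rightarrow>\<^sub>0 nat) \<Rightarrow>\<^sub>0 complex"

definition cconst :: "complex \<Rightarrow> 'i cpoly"
  where "cconst c = Poly_Mapping.single 0 c"

definition cvar :: "'i \<Rightarrow> 'i cpoly"
  where "cvar i = Poly_Mapping.single (Poly_Mapping.single i 1) 1"

definition cpoly_eval :: "('i \<Rightarrow> complex) \<Rightarrow> 'i cpoly \<Rightarrow> complex"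
  where "cpoly_eval a p =
    (\<Sum>m\<in>Poly_Mapping.keys p. Poly_Mapping.lookup p m *
       (\<Prod>i\<in>Poly_Mapping.keys m. a i ^ Poly_Mapping.lookup m i))"

definition homogeneous :: "nat \<Rightarrow> 'v::finite cpoly set"
  where "homogeneous k =
    {p. \<forall>m\<in>Poly_Mapping.keys p. (\<Sum>i\<in>UNIV. Poly_Mapping.lookup m i) = k}"

definition cscale :: "complex \<Rightarrow> 'i cpoly \<Rightarrow> 'i cpoly"
  where "cscale c p = cconst c * p"

interpretation cvec: vector_space cscale
  by unfold_locales
    (simp_all add: cscale_def cconst_def algebra_simps single_add mult_single
      flip: mult.assoc)

text \<open>\<open>cvec.span\<close>, \<open>cvec.subspace\<close> and \<open>cvec.dim\<close> are the complex linear notions;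
  \<open>ideal.subspace\<close> says that a set of ring elements is an ideal, and \<open>ideal.span S\<close> is the ideal
  generated by \<open>S\<close>.\<close>

interpretation ideal: module "(*) :: 'a::comm_ring_1 \<Rightarrow> 'a \<Rightarrow> 'a"
  by unfold_locales (simp_all add: algebra_simps)

definition ideal_prod :: "'a::comm_ring_1 set \<Rightarrow> 'a set \<Rightarrow> 'a set"
  where "ideal_prod I J = ideal.span {a * b |a b. a \<in> I \<and> b \<in> J}"

definition radical_ideal :: "'a::comm_ring_1 set \<Rightarrow> bool"
  where "radical_ideal I \<longleftrightarrow> ideal.subspace I \<and> (\<forall>f n. f ^ n \<in> I \<longrightarrow> f \<in> I)"

definition irrelevant_ideal :: "'v cpoly set"
  where "irrelevant_ideal = ideal.span (range cvar)"

definition Sym3 :: "'v cpoly set \<Rightarrow> 'v cpoly set"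
  where "Sym3 L = cvec.span {a * b * c |a b c. a \<in> L \<and> b \<in> L \<and> c \<in> L}"

section \<open>The Hilbert scheme of points of affine space\<close>

text \<open>\<open>coords_mod I B f c\<close> says that the class of \<open>f\<close> in the quotient by \<open>I\<close> is the linear
  combination with coefficients \<open>c\<close> of the classes of the elements of \<open>B\<close>.\<close>

definition coords_mod :: "'v cpoly set \<Rightarrow> 'v cpoly set \<Rightarrow> 'v cpoly \<Rightarrow> ('v cpoly \<Rightarrow> complex) \<Rightarrow> bool"
  where "coords_mod I B f c \<longleftrightarrow>
    (\<forall>b. b \<notin> B \<longrightarrow> c b = 0) \<and> f - (\<Sum>b\<in>B. cscale (c b) b) \<in> I"

text \<open>The elements of \<open>B\<close> are distinct modulo \<open>I\<close> and their classes are a basis of the quotient.\<close>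

definition basis_mod :: "'v cpoly set \<Rightarrow> 'v cpoly set \<Rightarrow> bool"
  where "basis_mod I B \<longleftrightarrow> finite B \<and> (\<forall>f. \<exists>!c. coords_mod I B f c)"

text \<open>The set of closed points of \<open>Hilb\<^sup>d\<close> of the affine space with coordinates indexed by \<open>'v\<close>.\<close>

definition Hilb :: "nat \<Rightarrow> 'v::finite cpoly set set"
  where "Hilb d = {I. ideal.subspace I \<and> (\<exists>B. card B = d \<and> basis_mod I B)}"

text \<open>The points of the affine chart \<open>U\<^sub>B\<close>: the ideals \<open>I\<close> for which \<open>B\<close> is a basis of the quotient
  by \<open>I\<close>. The coordinate ring of \<open>U\<^sub>B\<close> is generated by the coordinates, with respect to \<open>B\<close>, of the
  classes of the polynomials \<open>f\<close>.\<close>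

definition Hilb_chart :: "'v::finite cpoly set \<Rightarrow> 'v cpoly set set"
  where "Hilb_chart B = {I. ideal.subspace I \<and> basis_mod I B}"

definition chart_coord :: "'v cpoly set \<Rightarrow> 'v cpoly set \<Rightarrow> 'v cpoly \<times> 'v cpoly \<Rightarrow> complex"
  where "chart_coord B I = (\<lambda>(f, b). (THE c. coords_mod I B f c) b)"

text \<open>The Zariski topology on the closed points is generated by the nonvanishing loci on the charts
  of polynomials \<open>F\<close> in these coordinates.\<close>

definition Hilb_topology :: "nat \<Rightarrow> 'v::finite cpoly set topology"
  where "Hilb_topology d = topology_generated_by
    {{I \<in> Hilb_chart B. cpoly_eval (chart_coord B I) F \<noteq> 0} |B F. finite B \<and> card B = d}"

lemma topspace_Hilb_topology: "topspace (Hilb_topology d) = (Hilb d :: 'v::finite cpoly set set)"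
proof -
  have one: "cpoly_eval a 1 = 1" for a :: "('v cpoly \<times> 'v cpoly) \<Rightarrow> complex"
    by (simp add: cpoly_eval_def)
  have "I \<in> topspace (Hilb_topology d)" if I: "I \<in> Hilb d" for I :: "'v cpoly set"
  proof -
    obtain B where B: "card B = d" "I \<in> Hilb_chart B" "finite B"
      using I by (auto simp: Hilb_def Hilb_chart_def basis_mod_def)
    then have "I \<in> {J \<in> Hilb_chart B. cpoly_eval (chart_coord B J) 1 \<noteq> 0}"
      by (simp add: one)
    with B show ?thesis
      unfolding Hilb_topology_def topology_generated_by_topspace by blast
  qed
  moreover have "topspace (Hilb_topology d) \<subseteq> (Hilb d :: 'v cpoly set set)"
    unfolding Hilb_topology_def topology_generated_by_topspace
    by (auto simp: Hilb_def Hilb_chart_def)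
  ultimately show ?thesis by blast
qed

text \<open>A closed subscheme is reduced iff its ideal is radical. Since closed points are dense in
  every closed subset of a scheme of finite type over \<open>\<complex>\<close>, the closed points of the
  smoothable component are the closure, within the set of closed points, of the reduced ones.\<close>

definition smoothable_component :: "nat \<Rightarrow> 'v::finite cpoly set set"
  where "smoothable_component d = Hilb_topology d closure_of {I \<in> Hilb d. radical_ideal I}"

end

theory Submission
  imports Defs "Jordan_Normal_Form.Determinant"
begin

text \<open>Choose a basis \<open>a, b\<close> of \<open>L\<close> and give \<open>l\<close> weight 2 and \<open>a, b\<close> weight 1. Then \<open>v\<close> is homogeneous of
  weight 3 and \<open>I\<close> is spanned by \<open>v\<close> and all monomials of weight at least 4. Pick a polynomial \<open>V\<close>
  with leading form \<open>v\<close> such that every polynomial of weight at most 3 that vanishes on the surface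
  \<open>V = 0\<close> is a multiple of \<open>V\<close>: after a choice of basis \<open>v + 1\<close> or \<open>v + l\<close> will do. The 13-dimensional
  space of polynomials of weight at most 3 then restricts to a 12-dimensional space of functions on
  the surface, so some 12 points of the surface impose
  independent conditions on it. Hence the ideal of these points has initial ideal \<open>I\<close>, and scaling the
  points by \<open>(t\<^sup>2, t, t)\<close> gives a family of radical ideals with limit \<open>I\<close> as \<open>t\<close> tends to 0. To take
  the limit in the Zariski topology it suffices that the coordinates in one chart are continuous in
  \<open>t\<close>, because the change to any other chart is the inverse of a continuous matrix.\<close>

section \<open>Continuous families in the Hilbert scheme\<close>

text \<open>The classes of \<open>g 0\<close>, ..., \<open>g (d - 1)\<close> form a basis of the
  quotient by \<open>I\<close>. Numbering the basis, rather than taking a set as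
  \<open>basis_mod\<close> does, lets changes of basis be written as \<open>d\<close> by
  \<open>d\<close> matrices.\<close>

definition basis_family :: "'v cpoly set \<Rightarrow> nat \<Rightarrow> (nat \<Rightarrow> 'v cpoly) \<Rightarrow> bool"
  where "basis_family I d g \<longleftrightarrow>
    (\<forall>f. \<exists>c. f - (\<Sum>i<d. cscale (c i) (g i)) \<in> I) \<and>
    (\<forall>c. (\<Sum>i<d. cscale (c i) (g i)) \<in> I \<longrightarrow> (\<forall>i<d. c i = 0))"

lemma ideal_cscale:
  assumes "ideal.subspace I" "f \<in> I"
  shows "cscale c f \<in> I"
  using assms by (simp add: cscale_def ideal.subspace_scale)

lemma basis_family_unique:
  assumes "ideal.subspace I" "basis_family I d g"
    and "f - (\<Sum>i<d. cscale (c i) (g i)) \<in> I" "f - (\<Sum>i<d. cscale (c' i) (g i)) \<in> I"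
    and "i < d"
  shows "c i = c' i"
proof -
  have "(f - (\<Sum>i<d. cscale (c' i) (g i))) - (f - (\<Sum>i<d. cscale (c i) (g i))) \<in> I"
    using assms by (blast intro: ideal.subspace_diff)
  also have "(f - (\<Sum>i<d. cscale (c' i) (g i))) - (f - (\<Sum>i<d. cscale (c i) (g i)))
    = (\<Sum>i<d. cscale (c i - c' i) (g i))"
    by (simp add: cvec.scale_left_diff_distrib sum_subtractf)
  finally show ?thesis
    using assms by (auto simp: basis_family_def)
qed

lemma sum_cscale_delta:
  "k < d \<Longrightarrow> (\<Sum>m<d. cscale (if k = m then 1 else 0) (g m)) = g k"
  for d :: nat
proof -
  assume k: "k < d"
  have "(\<Sum>m<d. cscale (if k = m then 1 else 0) (g m)) = (\<Sum>m<d. if m = k then g m else 0)"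
    by (rule sum.cong) auto
  with k show ?thesis by simp
qed

lemma basis_family_inj:
  assumes I: "ideal.subspace I" and g: "basis_family I d g"
  shows "inj_on g {..<d}"
proof (rule inj_onI, rule ccontr)
  fix i j assume ij: "i \<in> {..<d}" "j \<in> {..<d}" "g i = g j" "i \<noteq> j"
  have "0 \<in> I" using I by (rule ideal.subspace_0)
  have "(if i = i then 1 else 0 :: complex) = (if j = i then 1 else 0)"
    by (rule basis_family_unique[OF I g, of "g i" "\<lambda>k. if i = k then 1 else 0" "\<lambda>k. if j = k then 1 else 0"])
      (use ij \<open>0 \<in> I\<close> in \<open>simp_all add: sum_cscale_delta\<close>)
  with ij show False by simp
qed

lemma basis_mod_iff_family:
  fixes B :: "'v cpoly set"
  assumes I: "ideal.subspace I" and g: "bij_betw g {..<d} B"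
  shows "basis_mod I B \<longleftrightarrow> basis_family I d g"
proof
  have fin: "finite B" using g bij_betw_finite by blast
  have inj: "inj_on g {..<d}" using g by (simp add: bij_betw_def)
  have re: "(\<Sum>b\<in>B. cscale (c b) b) = (\<Sum>i<d. cscale (c (g i)) (g i))" for c
    using sum.reindex_bij_betw[OF g, of "\<lambda>b. cscale (c b) b"] by simp
  \<comment> \<open>The extension by zero off \<open>B\<close> is what \<open>coords_mod\<close>
    demands of a coefficient function; it makes the function on \<open>B\<close> correspond uniquely
    to the numbers \<open>c i\<close> with \<open>i < d\<close>.\<close>
  define up where "up c = (\<lambda>b. if b \<in> B then c (inv_into {..<d} g b) else 0)" for c :: "nat \<Rightarrow> complex"
  have up: "up c (g i) = c i" if "i < d" for c i
    using that inj g by (auto simp: up_def bij_betw_def)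
  have up_out: "b \<notin> B \<Longrightarrow> up c b = 0" for c b
    by (simp add: up_def)
  have up_sum: "(\<Sum>b\<in>B. cscale (up c b) b) = (\<Sum>i<d. cscale (c i) (g i))" for c
    unfolding re by (rule sum.cong) (auto simp: up)
  {
    assume b: "basis_mod I B"
    show "basis_family I d g"
      unfolding basis_family_def
    proof (intro conjI allI impI)
      fix f
      obtain c where "coords_mod I B f c"
        using b unfolding basis_mod_def by blast
      then show "\<exists>c. f - (\<Sum>i<d. cscale (c i) (g i)) \<in> I"
        unfolding coords_mod_def re by (intro exI[of _ "\<lambda>i. c (g i)"]) simp
    next
      fix c i assume c: "(\<Sum>i<d. cscale (c i) (g i)) \<in> I" and i: "i < d"
      have "coords_mod I B 0 (up c)"
        using ideal.subspace_neg[OF I c] by (simp add: coords_mod_def up_sum up_out)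
      moreover have "coords_mod I B 0 (\<lambda>b. 0)"
        using ideal.subspace_0[OF I] by (simp add: coords_mod_def)
      ultimately have "up c = (\<lambda>b. 0)"
        using b unfolding basis_mod_def by blast
      then show "c i = 0"
        using up[OF i, of c] by simp
    qed
  }
  {
    assume b: "basis_family I d g"
    show "basis_mod I B"
      unfolding basis_mod_def
    proof (intro conjI allI fin)
      fix f
      obtain c where c: "f - (\<Sum>i<d. cscale (c i) (g i)) \<in> I"
        using b unfolding basis_family_def by blast
      show "\<exists>!c. coords_mod I B f c"
      proof (rule ex1I)
        show "coords_mod I B f (up c)"
          using c by (simp add: coords_mod_def up_sum up_out)
      next
        fix c' assume c': "coords_mod I B f c'"
        show "c' = up c"
        proof
          fix x
          show "c' x = up c x"
          proof (cases "x \<in> B")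
            case True
            then obtain i where i: "i < d" "x = g i"
              using g by (auto simp: bij_betw_def)
            have "c' (g i) = c i"
              by (rule basis_family_unique[OF I b _ c i(1)])
                (use c' in \<open>simp add: coords_mod_def re\<close>)
            with i up show ?thesis by simp
          next
            case False
            then show ?thesis using c' up_out by (simp add: coords_mod_def)
          qed
        qed
      qed
    qed
  }
qed

lemma chart_coord_family:
  fixes d :: nat
  assumes I: "ideal.subspace I" and g: "bij_betw g {..<d} B" and B: "basis_mod I B"
    and c: "f - (\<Sum>i<d. cscale (c i) (g i)) \<in> I" and i: "i < d"
  shows "chart_coord B I (f, g i) = c i"
proof -
  have ex1: "\<exists>!c. coords_mod I B f c"
    using B by (simp add: basis_mod_def)
  have "coords_mod I B f (THE c. coords_mod I B f c)"
    using ex1 by (rule theI')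
  then have "f - (\<Sum>i<d. cscale ((THE c. coords_mod I B f c) (g i)) (g i)) \<in> I"
    using sum.reindex_bij_betw[OF g, of "\<lambda>b. cscale ((THE c. coords_mod I B f c) b) b"]
    by (simp add: coords_mod_def)
  with I basis_mod_iff_family[OF I g] B c i show ?thesis
    by (auto simp: chart_coord_def intro: basis_family_unique)
qed

lemma chart_coord_outside:
  assumes "basis_mod I B" "b \<notin> B"
  shows "chart_coord B I (f, b) = 0"
proof -
  have "\<exists>!c. coords_mod I B f c"
    using assms(1) by (simp add: basis_mod_def)
  then have "coords_mod I B f (THE c. coords_mod I B f c)"
    by (rule theI')
  with assms show ?thesis by (simp add: chart_coord_def coords_mod_def)
qed

section \<open>Continuity of determinants and inverse matrices\<close>

lemma isCont_det:
  fixes A :: "'a::t2_space \<Rightarrow> complex mat"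
  assumes "\<And>t. A t \<in> carrier_mat n n"
    and "\<And>i j. i < n \<Longrightarrow> j < n \<Longrightarrow> isCont (\<lambda>t. A t $$ (i, j)) t0"
  shows "isCont (\<lambda>t. Determinant.det (A t)) t0"
proof -
  have "isCont (\<lambda>t. A t $$ (i, p i)) t0" if "p permutes {0..<n}" "i \<in> {0..<n}" for p i
    using that permutes_in_image[of p "{0..<n}" i] by (intro assms(2)) auto
  then show ?thesis
    unfolding det_def'[OF assms(1)]
    by (intro continuous_sum continuous_mult continuous_const continuous_prod) auto
qed

text \<open>Each entry of the adjugate is, up to sign, a minor, and so the determinant of a matrix
  with continuous entries. The indices jump by one past the deleted row and column.\<close>

lemma isCont_adj_mat:
  fixes A :: "'a::t2_space \<Rightarrow> complex mat"
  assumes A: "\<And>t. A t \<in> carrier_mat n n"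
    and cont: "\<And>i j. i < n \<Longrightarrow> j < n \<Longrightarrow> isCont (\<lambda>t. A t $$ (i, j)) t0"
    and i: "i < n" and j: "j < n"
  shows "isCont (\<lambda>t. adj_mat (A t) $$ (i, j)) t0"
proof -
  have "isCont (\<lambda>t. Determinant.det (mat_delete (A t) j i)) t0"
  proof (rule isCont_det)
    show "mat_delete (A t) j i \<in> carrier_mat (n - 1) (n - 1)" for t
      using A by (rule mat_delete_carrier)
  next
    fix i' j' assume ij: "i' < n - 1" "j' < n - 1"
    have "mat_delete (A t) j i $$ (i', j') =
      A t $$ (if i' < j then i' else Suc i', if j' < i then j' else Suc j')" for t
      using A[of t] ij by (auto simp: mat_delete_def)
    moreover have "isCont (\<lambda>t. A t $$ (if i' < j then i' else Suc i', if j' < i then j' else Suc j')) t0"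
      using ij by (intro cont) auto
    ultimately show "isCont (\<lambda>t. mat_delete (A t) j i $$ (i', j')) t0"
      by simp
  qed
  moreover have "adj_mat (A t) $$ (i, j) = (-1) ^ (j + i) * Determinant.det (mat_delete (A t) j i)" for t
    using A[of t] i j by (simp add: adj_mat_def cofactor_def)
  ultimately show ?thesis
    by (simp add: continuous_mult)
qed

text \<open>By Cramer's rule the inverse is the adjugate divided by the determinant. A right inverse
  at \<open>t0\<close> makes the determinant nonzero there, and by continuity it stays nonzero
  nearby. Both products are recorded because both are needed for a change of basis.\<close>

lemma isCont_matrix_inverse:
  fixes M :: "complex \<Rightarrow> nat \<Rightarrow> nat \<Rightarrow> complex"
  assumes cont: "\<And>i j. i < d \<Longrightarrow> j < d \<Longrightarrow> isCont (\<lambda>t. M t i j) t0"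
    and inv: "\<And>i j. i < d \<Longrightarrow> j < d \<Longrightarrow> (\<Sum>k<d. M t0 i k * N0 k j) = (if i = j then 1 else 0)"
  obtains N where "\<And>i j. i < d \<Longrightarrow> j < d \<Longrightarrow> isCont (\<lambda>t. N t i j) t0"
    and "\<forall>\<^sub>F t in nhds t0. \<forall>i<d. \<forall>j<d. (\<Sum>k<d. M t i k * N t k j) = (if i = j then 1 else 0)"
    and "\<forall>\<^sub>F t in nhds t0. \<forall>i<d. \<forall>j<d. (\<Sum>k<d. N t i k * M t k j) = (if i = j then 1 else 0)"
proof -
  define A where "A t = mat d d (\<lambda>(i, j). M t i j)" for t
  have A: "A t \<in> carrier_mat d d" for t
    by (simp add: A_def)
  have A_nth: "A t $$ (i, j) = M t i j" if "i < d" "j < d" for t i j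
    using that by (simp add: A_def)
  have contA: "isCont (\<lambda>t. A t $$ (i, j)) t0" if "i < d" "j < d" for i j
    using that cont by (simp add: A_nth)
  define B where "B = mat d d (\<lambda>(i, j). N0 i j)"
  have B: "B \<in> carrier_mat d d" by (simp add: B_def)
  have "A t0 * B = 1\<^sub>m d"
    by (rule eq_matI)
      (auto simp: A_def B_def scalar_prod_def inv atLeast0LessThan)
  then have "Determinant.det (A t0) * Determinant.det B = 1"
    using det_mult[OF A[of t0] B] by simp
  then have det0: "Determinant.det (A t0) \<noteq> 0"
    by auto
  have contdet: "isCont (\<lambda>t. Determinant.det (A t)) t0"
    by (rule isCont_det[OF A contA])
  then have "((\<lambda>t. Determinant.det (A t)) \<longlongrightarrow> Determinant.det (A t0)) (nhds t0)"
    using tendsto_at_iff_tendsto_nhds[of "\<lambda>t. Determinant.det (A t)" t0] by (simp add: isCont_def)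
  from tendsto_imp_eventually_ne[OF this det0]
  have ev: "\<forall>\<^sub>F t in nhds t0. Determinant.det (A t) \<noteq> 0" .
  define N where "N t i j = adj_mat (A t) $$ (i, j) / Determinant.det (A t)" for t i j
  have adj: "adj_mat (A t) \<in> carrier_mat d d" for t
    using adj_mat[OF A] by blast
  have "(\<Sum>k<d. M t i k * N t k j) = (if i = j then 1 else 0)"
    if "Determinant.det (A t) \<noteq> 0" "i < d" "j < d" for t i j
  proof -
    have "(\<Sum>k<d. M t i k * adj_mat (A t) $$ (k, j)) = (A t * adj_mat (A t)) $$ (i, j)"
      using that A[of t] adj[of t]
      by (auto simp: scalar_prod_def atLeast0LessThan A_nth intro!: sum.cong)
    also have "\<dots> = (if i = j then Determinant.det (A t) else 0)"
      using that by (simp add: adj_mat(2)[OF A])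
    finally show ?thesis
      using that by (auto simp: N_def simp flip: sum_divide_distrib)
  qed
  moreover have "(\<Sum>k<d. N t i k * M t k j) = (if i = j then 1 else 0)"
    if "Determinant.det (A t) \<noteq> 0" "i < d" "j < d" for t i j
  proof -
    have "(\<Sum>k<d. adj_mat (A t) $$ (i, k) * M t k j) = (adj_mat (A t) * A t) $$ (i, j)"
      using that A[of t] adj[of t]
      by (auto simp: scalar_prod_def atLeast0LessThan A_nth intro!: sum.cong)
    also have "\<dots> = (if i = j then Determinant.det (A t) else 0)"
      using that by (simp add: adj_mat(3)[OF A])
    finally show ?thesis
      using that by (auto simp: N_def simp flip: sum_divide_distrib)
  qed
  moreover have "isCont (\<lambda>t. N t i j) t0" if "i < d" "j < d" for i j
    unfolding N_def
    by (intro isCont_divide isCont_adj_mat[OF A contA] that contdet det0)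
  ultimately show ?thesis
    by (intro that[of N] eventually_mono[OF ev]) auto
qed

text \<open>Modulo \<open>I\<close>, composing two changes of generators multiplies their
  coefficient matrices.\<close>

lemma ideal_substitute:
  fixes g h :: "nat \<Rightarrow> 'v cpoly"
  assumes I: "ideal.subspace I"
    and f: "f - (\<Sum>k<d. cscale (a k) (g k)) \<in> I"
    and g: "\<And>k. k < d \<Longrightarrow> g k - (\<Sum>j<d. cscale (n k j) (h j)) \<in> I"
  shows "f - (\<Sum>j<d. cscale (\<Sum>k<d. a k * n k j) (h j)) \<in> I"
proof -
  have "(\<Sum>k<d. cscale (a k) (g k - (\<Sum>j<d. cscale (n k j) (h j)))) \<in> I"
    by (intro ideal.subspace_sum[OF I] ideal_cscale[OF I] g) simp
  with I f have "f - (\<Sum>k<d. cscale (a k) (g k)) +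
      (\<Sum>k<d. cscale (a k) (g k - (\<Sum>j<d. cscale (n k j) (h j)))) \<in> I"
    by (rule ideal.subspace_add)
  also have "f - (\<Sum>k<d. cscale (a k) (g k)) +
      (\<Sum>k<d. cscale (a k) (g k - (\<Sum>j<d. cscale (n k j) (h j))))
    = f - (\<Sum>k<d. \<Sum>j<d. cscale (a k * n k j) (h j))"
    by (simp add: cvec.scale_right_diff_distrib sum_subtractf cvec.scale_sum_right)
  also have "(\<Sum>k<d. \<Sum>j<d. cscale (a k * n k j) (h j)) = (\<Sum>j<d. cscale (\<Sum>k<d. a k * n k j) (h j))"
    by (subst sum.swap) (simp add: cvec.scale_sum_left)
  finally show ?thesis .
qed

lemma Hilb_family:
  assumes I: "ideal.subspace I" and g: "basis_family I d g"
  shows "I \<in> Hilb d"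
proof -
  have inj: "inj_on g {..<d}"
    using I g by (rule basis_family_inj)
  then have "basis_mod I (g ` {..<d})"
    using basis_mod_iff_family[OF I] g inj_on_imp_bij_betw by blast
  moreover have "card (g ` {..<d}) = d"
    using inj by (simp add: card_image)
  ultimately show ?thesis
    using I by (auto simp: Hilb_def)
qed

text \<open>A single family \<open>g\<close> is a basis of the quotient by every \<open>K t\<close>,
  and the coordinates of each polynomial in it are continuous at \<open>0\<close>. This is
  continuity of the path in one chart; below it is transferred to the other charts.\<close>

locale ideal_path =
  fixes K :: "complex \<Rightarrow> 'v::finite cpoly set" and d :: nat and g :: "nat \<Rightarrow> 'v cpoly"
  assumes ideal: "ideal.subspace (K t)"
    and coords: "\<exists>C. (\<forall>t. f - (\<Sum>i<d. cscale (C t i) (g i)) \<in> K t) \<and> (\<forall>i<d. isCont (\<lambda>t. C t i) 0)"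
    and indep: "(\<Sum>i<d. cscale (c i) (g i)) \<in> K t \<Longrightarrow> i < d \<Longrightarrow> c i = 0"
begin

lemma family: "basis_family (K t) d g"
  using coords indep unfolding basis_family_def by blast

text \<open>Coordinates with respect to \<open>B\<close> arise from those with respect to
  \<open>g\<close> through the inverse of the matrix that expresses \<open>B\<close> in terms of
  \<open>g\<close>. That matrix is invertible at \<open>0\<close> because \<open>K 0\<close> lies in
  the chart of \<open>B\<close>, hence also for \<open>t\<close> near \<open>0\<close>.\<close>

lemma chart_coord_isCont:
  assumes B: "finite B" "card B = d" and K0: "K 0 \<in> Hilb_chart B"
  obtains D where "\<forall>\<^sub>F t in nhds 0. K t \<in> Hilb_chart B \<and> chart_coord B (K t) = D t"
    and "\<And>x. isCont (\<lambda>t. D t x) 0"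
proof -
  have "\<forall>f. \<exists>C. (\<forall>t. f - (\<Sum>i<d. cscale (C t i) (g i)) \<in> K t) \<and> (\<forall>i<d. isCont (\<lambda>t. C t i) 0)"
    using coords by simp
  from choice[OF this] obtain C where C: "\<And>f t. f - (\<Sum>i<d. cscale (C f t i) (g i)) \<in> K t"
    and contC: "\<And>f i. i < d \<Longrightarrow> isCont (\<lambda>t. C f t i) 0"
    by auto
  obtain h where h: "bij_betw h {..<d} B"
    using ex_bij_betw_nat_finite[OF B(1)] B(2) by (auto simp: atLeast0LessThan)
  define M where "M t i j = C (h i) t j" for t i j
  have M: "h i - (\<Sum>j<d. cscale (M t i j) (g j)) \<in> K t" for t i
    unfolding M_def by (rule C)
  have h0: "basis_family (K 0) d h"
    using K0 basis_mod_iff_family[OF ideal h] by (simp add: Hilb_chart_def)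
  then have "\<forall>k. \<exists>n. g k - (\<Sum>j<d. cscale (n j) (h j)) \<in> K 0"
    by (simp add: basis_family_def)
  from choice[OF this] obtain N0 where N0: "\<And>k. g k - (\<Sum>j<d. cscale (N0 k j) (h j)) \<in> K 0"
    by auto
  \<comment> \<open>Writing \<open>h\<close> through \<open>g\<close> and then \<open>g\<close>
    through \<open>h\<close> modulo \<open>K 0\<close> must give the identity, by uniqueness of
    coordinates in \<open>h\<close>.\<close>
  have inv: "(\<Sum>k<d. M 0 i k * N0 k j) = (if i = j then 1 else 0)" if "i < d" "j < d" for i j
    using that
    by (intro basis_family_unique[OF ideal h0 ideal_substitute[OF ideal M N0],
          where i = j and c' = "\<lambda>j. if i = j then 1 else 0"])
      (simp_all add: sum_cscale_delta ideal.subspace_0[OF ideal])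
  have contM: "isCont (\<lambda>t. M t i j) 0" if "i < d" "j < d" for i j
    unfolding M_def using that(2) by (rule contC)
  obtain N where contN: "\<And>i j. i < d \<Longrightarrow> j < d \<Longrightarrow> isCont (\<lambda>t. N t i j) 0"
    and MN: "\<forall>\<^sub>F t in nhds 0. \<forall>i<d. \<forall>j<d. (\<Sum>k<d. M t i k * N t k j) = (if i = j then 1 else 0)"
    and NM: "\<forall>\<^sub>F t in nhds 0. \<forall>i<d. \<forall>j<d. (\<Sum>k<d. N t i k * M t k j) = (if i = j then 1 else 0)"
    using isCont_matrix_inverse[where M = M, OF contM inv] by blast
  \<comment> \<open>The value zero off \<open>B\<close> matches the behaviour of
    \<open>chart_coord\<close> there.\<close>
  define D where "D t = (\<lambda>(f, b). if b \<in> B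
    then \<Sum>k<d. C f t k * N t k (inv_into {..<d} h b) else 0)" for t
  have inv_h: "inv_into {..<d} h b < d" if "b \<in> B" for b
    using that h inv_into_into[of b h "{..<d}"] by (auto simp: bij_betw_def)
  show thesis
  proof (rule that)
    fix x :: "'v cpoly \<times> 'v cpoly"
    obtain f b where x: "x = (f, b)" by fastforce
    show "isCont (\<lambda>t. D t x) 0"
    proof (cases "b \<in> B")
      case True
      then show ?thesis
        unfolding D_def x using contC contN inv_h
        by (auto intro!: continuous_sum continuous_mult)
    qed (simp add: D_def x)
  next
    have "K t \<in> Hilb_chart B \<and> chart_coord B (K t) = D t"
      if MN: "\<forall>i<d. \<forall>j<d. (\<Sum>k<d. M t i k * N t k j) = (if i = j then 1 else 0)"
        and NM: "\<forall>i<d. \<forall>j<d. (\<Sum>k<d. N t i k * M t k j) = (if i = j then 1 else 0)" for t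
    proof -
      \<comment> \<open>That \<open>N t\<close> is a left inverse of \<open>M t\<close> turns the
        expression of \<open>h\<close> in \<open>g\<close> into one of \<open>g\<close> in
        \<open>h\<close>.\<close>
      have gh: "g k - (\<Sum>j<d. cscale (N t k j) (h j)) \<in> K t" if k: "k < d" for k
      proof -
        let ?f = "\<Sum>j<d. cscale (N t k j) (h j)"
        have "?f - (\<Sum>m<d. cscale (\<Sum>j<d. N t k j * M t j m) (g m)) \<in> K t"
          by (rule ideal_substitute[OF ideal _ M]) (simp add: ideal.subspace_0[OF ideal])
        also have "(\<Sum>m<d. cscale (\<Sum>j<d. N t k j * M t j m) (g m)) = g k"
          using k NM by (simp add: sum_cscale_delta)
        finally show ?thesis
          using ideal.subspace_neg[OF ideal] by fastforce
      qed
      have fh: "f - (\<Sum>j<d. cscale (\<Sum>k<d. C f t k * N t k j) (h j)) \<in> K t" for f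
        by (rule ideal_substitute[OF ideal C gh])
      have "basis_family (K t) d h"
        unfolding basis_family_def
      proof (intro conjI allI impI)
        show "\<exists>c. f - (\<Sum>j<d. cscale (c j) (h j)) \<in> K t" for f
          by (rule exI, rule fh)
      next
        fix x j assume x: "(\<Sum>i<d. cscale (x i) (h i)) \<in> K t" and j: "j < d"
        let ?f = "\<Sum>i<d. cscale (x i) (h i)"
        have "?f - (\<Sum>m<d. cscale (\<Sum>i<d. x i * M t i m) (g m)) \<in> K t"
          by (rule ideal_substitute[OF ideal _ M]) (simp add: ideal.subspace_0[OF ideal])
        from ideal.subspace_diff[OF ideal x this]
        have "(\<Sum>m<d. cscale (\<Sum>i<d. x i * M t i m) (g m)) \<in> K t"
          by simp
        then have xM: "(\<Sum>i<d. x i * M t i m) = 0" if "m < d" for m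
          by (rule indep[where c = "\<lambda>m. \<Sum>i<d. x i * M t i m"]) (rule that)
        \<comment> \<open>From \<open>x M = 0\<close> follows \<open>x = x M N = 0\<close>; this
          uses that \<open>N t\<close> is also a right inverse.\<close>
        have "x j = (\<Sum>i<d. if i = j then x i else 0)"
          using j by simp
        also have "\<dots> = (\<Sum>i<d. x i * (if i = j then 1 else 0))"
          by (rule sum.cong) auto
        also have "\<dots> = (\<Sum>i<d. x i * (\<Sum>m<d. M t i m * N t m j))"
          by (rule sum.cong) (use j MN in auto)
        also have "\<dots> = (\<Sum>i<d. \<Sum>m<d. x i * M t i m * N t m j)"
          by (simp only: sum_distrib_left mult.assoc)
        also have "\<dots> = (\<Sum>m<d. (\<Sum>i<d. x i * M t i m) * N t m j)"
          by (subst sum.swap) (simp only: sum_distrib_right)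
        finally show "x j = 0"
          by (simp add: xM)
      qed
      then have Bt: "basis_mod (K t) B"
        using basis_mod_iff_family[OF ideal h] by simp
      have "chart_coord B (K t) (f, b) = D t (f, b)" for f b
      proof (cases "b \<in> B")
        case True
        define j where "j = inv_into {..<d} h b"
        have hj: "h j = b" and "j < d"
          using True h inv_h by (auto simp: j_def bij_betw_def f_inv_into_f)
        with chart_coord_family[OF ideal h Bt fh[of f] \<open>j < d\<close>] True show ?thesis
          by (simp add: D_def flip: j_def)
      next
        case False
        with Bt show ?thesis by (simp add: D_def chart_coord_outside)
      qed
      with Bt ideal show ?thesis by (auto simp: Hilb_chart_def)
    qed
    with MN NM show "\<forall>\<^sub>F t in nhds 0. K t \<in> Hilb_chart B \<and> chart_coord B (K t) = D t"
      by (auto elim: eventually_elim2)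
  qed
qed

text \<open>Finite intersections and unions are handled by induction on the generated topology. On a
  basic open set the chart coordinates of \<open>K t\<close> are continuous at \<open>0\<close>, so
  a polynomial in them that is nonzero at \<open>0\<close> stays nonzero nearby.\<close>

lemma eventually_open:
  assumes "openin (Hilb_topology d) U" "K 0 \<in> U"
  shows "\<forall>\<^sub>F t in nhds 0. K t \<in> U"
proof -
  have "generate_topology_on
    {{I \<in> Hilb_chart B. cpoly_eval (chart_coord B I) F \<noteq> 0} |B F. finite B \<and> card B = d} U"
    using assms(1) unfolding Hilb_topology_def by (rule openin_topology_generated_by)
  then show ?thesis
    using assms(2)
  proof induction
    case (Basis s)
    then obtain B F where s: "s = {I \<in> Hilb_chart B. cpoly_eval (chart_coord B I) F \<noteq> 0}"
      and B: "finite B" "card B = d"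
      by blast
    with Basis have K0: "K 0 \<in> Hilb_chart B" "cpoly_eval (chart_coord B (K 0)) F \<noteq> 0"
      by auto
    obtain D where D: "\<forall>\<^sub>F t in nhds 0. K t \<in> Hilb_chart B \<and> chart_coord B (K t) = D t"
      and contD: "\<And>x. isCont (\<lambda>t. D t x) 0"
      using chart_coord_isCont[OF B K0(1)] by blast
    \<comment> \<open>The filter \<open>nhds 0\<close> sees the point \<open>0\<close>
      itself.\<close>
    have "chart_coord B (K 0) = D 0"
      using eventually_nhds_x_imp_x[OF D] by simp
    with K0 have ne: "cpoly_eval (D 0) F \<noteq> 0" by simp
    have "isCont (\<lambda>t. cpoly_eval (D t) F) 0"
      unfolding cpoly_eval_def
      by (intro continuous_intros contD)
    then have "((\<lambda>t. cpoly_eval (D t) F) \<longlongrightarrow> cpoly_eval (D 0) F) (nhds 0)"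
      using tendsto_at_iff_tendsto_nhds[of "\<lambda>t. cpoly_eval (D t) F" 0] by (simp add: isCont_def)
    from tendsto_imp_eventually_ne[OF this ne] D show ?case
      by eventually_elim (auto simp: s)
  next
    case (Int a b)
    then show ?case by (auto intro: eventually_conj)
  next
    case (UN A)
    then obtain S where S: "S \<in> A" "K 0 \<in> S" by blast
    with UN have "\<forall>\<^sub>F t in nhds 0. K t \<in> S" by blast
    with S show ?case by (auto elim: eventually_mono)
  qed simp
qed

lemma in_Hilb: "K t \<in> Hilb d"
  using ideal family by (rule Hilb_family)

text \<open>Punctured neighbourhoods of \<open>0\<close> in the complex plane are nonempty, so every
  open set around \<open>K 0\<close> contains some \<open>K t\<close> with \<open>t\<close>
  nonzero.\<close>

lemma in_closure:
  assumes X: "\<And>t. t \<noteq> 0 \<Longrightarrow> K t \<in> X"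
  shows "K 0 \<in> Hilb_topology d closure_of X"
  unfolding in_closure_of
proof (intro conjI allI impI)
  show "K 0 \<in> topspace (Hilb_topology d)"
    by (simp add: topspace_Hilb_topology in_Hilb)
next
  fix U assume "K 0 \<in> U \<and> openin (Hilb_topology d) U"
  then have "\<forall>\<^sub>F t in nhds 0. K t \<in> U"
    using eventually_open by blast
  then have "\<forall>\<^sub>F t in at 0. K t \<in> U"
    by (simp add: eventually_at_filter eventually_mono)
  moreover have "\<forall>\<^sub>F t in at (0::complex). t \<noteq> 0"
    by (simp add: eventually_at_filter)
  ultimately have "\<forall>\<^sub>F t in at 0. K t \<in> U \<and> t \<noteq> 0"
    by (rule eventually_conj)
  then obtain t where "K t \<in> U" "t \<noteq> 0"
    using eventually_happens'[OF at_neq_bot] by blast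
  with X show "\<exists>I. I \<in> X \<and> I \<in> U" by blast
qed

end

section \<open>Points in general position on a surface\<close>

text \<open>Functions that are linearly independent on \<open>S\<close> remain so on suitably chosen
  points of \<open>S\<close>, as many as there are functions. The points are found one by one: the
  new function minus its interpolant on the old points is not zero on all of \<open>S\<close>, and a
  point where it is nonzero is added.\<close>

lemma interpolation_points:
  fixes \<phi> :: "'q \<Rightarrow> 'e \<Rightarrow> complex"
  assumes "finite A"
    and "\<And>p. (\<And>q. q \<in> S \<Longrightarrow> (\<Sum>e\<in>A. p e * \<phi> q e) = 0) \<Longrightarrow> \<forall>e\<in>A. p e = 0"
  shows "\<exists>Q\<subseteq>S. finite Q \<and> card Q = card A \<and>
    (\<forall>p. (\<forall>q\<in>Q. (\<Sum>e\<in>A. p e * \<phi> q e) = 0) \<longrightarrow> (\<forall>e\<in>A. p e = 0)) \<and>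
    (\<forall>f. \<exists>p. \<forall>q\<in>Q. (\<Sum>e\<in>A. p e * \<phi> q e) = f q)"
  using assms
proof induction
  case empty
  show ?case by (intro exI[of _ "{}"]) auto
next
  case (insert a A)
  have "\<forall>e\<in>A. p e = 0" if p: "\<And>q. q \<in> S \<Longrightarrow> (\<Sum>e\<in>A. p e * \<phi> q e) = 0" for p
  proof -
    have "(\<Sum>e\<in>A. (if e = a then 0 else p e) * \<phi> q e) = (\<Sum>e\<in>A. p e * \<phi> q e)" for q
      by (rule sum.cong) (use insert.hyps in auto)
    then have "\<forall>e\<in>insert a A. (if e = a then 0 else p e) = 0"
      using p insert.hyps by (intro insert.prems) simp
    with insert.hyps show ?thesis by (metis insert_iff)
  qed
  from insert.IH[OF this] obtain Q where Q: "Q \<subseteq> S" "finite Q" "card Q = card A"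
    and uniq: "\<And>p. (\<And>q. q \<in> Q \<Longrightarrow> (\<Sum>e\<in>A. p e * \<phi> q e) = 0) \<Longrightarrow> \<forall>e\<in>A. p e = 0"
    and interp: "\<And>f. \<exists>p. \<forall>q\<in>Q. (\<Sum>e\<in>A. p e * \<phi> q e) = f q"
    by auto
  obtain r where r: "\<And>q. q \<in> Q \<Longrightarrow> (\<Sum>e\<in>A. r e * \<phi> q e) = \<phi> q a"
    using interp[of "\<lambda>q. \<phi> q a"] by blast
  define h where "h q = \<phi> q a - (\<Sum>e\<in>A. r e * \<phi> q e)" for q
  \<comment> \<open>With \<open>h\<close> in place of the new function the evaluation matrix becomes
    triangular, since \<open>h\<close> vanishes on the old points.\<close>
  have sum_eq: "(\<Sum>e\<in>insert a A. p e * \<phi> q e) =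
      p a * h q + (\<Sum>e\<in>A. (p e + p a * r e) * \<phi> q e)" for p q
  proof -
    have "(\<Sum>e\<in>A. (p e + p a * r e) * \<phi> q e) = (\<Sum>e\<in>A. p e * \<phi> q e) + p a * (\<Sum>e\<in>A. r e * \<phi> q e)"
      by (simp only: distrib_right sum.distrib sum_distrib_left mult.assoc)
    then show ?thesis
      using insert.hyps by (simp add: h_def right_diff_distrib)
  qed
  have "\<exists>q\<in>S. h q \<noteq> 0"
  proof (rule ccontr)
    assume contra: "\<not> ?thesis"
    have "(\<Sum>e\<in>insert a A. (if e = a then 1 else - r e) * \<phi> q e) = h q" for q
    proof -
      have "(\<Sum>e\<in>A. (if e = a then 1 else - r e) * \<phi> q e) = (\<Sum>e\<in>A. - (r e * \<phi> q e))"
        by (rule sum.cong) (use insert.hyps in auto)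
      then show ?thesis
        using insert.hyps by (simp add: h_def sum_negf)
    qed
    with contra have "\<forall>e\<in>insert a A. (if e = a then 1 else - r e) = 0"
      by (intro insert.prems) auto
    then show False by simp
  qed
  then obtain s where s: "s \<in> S" "h s \<noteq> 0" by blast
  have hQ: "h q = 0" if "q \<in> Q" for q
    using r[OF that] by (simp add: h_def)
  then have "s \<notin> Q" using s by auto
  show ?case
  proof (intro exI[of _ "insert s Q"] conjI allI impI)
    show "insert s Q \<subseteq> S" "finite (insert s Q)" using s Q by auto
    show "card (insert s Q) = card (insert a A)"
      using insert.hyps Q \<open>s \<notin> Q\<close> by simp
  next
    fix p assume p: "\<forall>q\<in>insert s Q. (\<Sum>e\<in>insert a A. p e * \<phi> q e) = 0"
    have z: "\<forall>e\<in>A. p e + p a * r e = 0"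
      by (rule uniq) (use p hQ sum_eq[of p] in auto)
    then have "p a * h s = 0"
      using p sum_eq[of p s] by simp
    with s have "p a = 0" by simp
    with z show "\<forall>e\<in>insert a A. p e = 0" by simp
  next
    fix f :: "'q \<Rightarrow> complex"
    obtain p where p: "\<And>q. q \<in> Q \<Longrightarrow> (\<Sum>e\<in>A. p e * \<phi> q e) = f q"
      using interp by blast
    \<comment> \<open>As in Newton interpolation, adding \<open>c * h\<close> corrects the value at
      \<open>s\<close> and leaves those on \<open>Q\<close> unchanged.\<close>
    define c where "c = (f s - (\<Sum>e\<in>A. p e * \<phi> s e)) / h s"
    define p' where "p' = (\<lambda>e. if e = a then c else p e - c * r e)"
    have "(\<Sum>e\<in>insert a A. p' e * \<phi> q e) = c * h q + (\<Sum>e\<in>A. p e * \<phi> q e)" for q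
    proof -
      have "(\<Sum>e\<in>A. (p' e + p' a * r e) * \<phi> q e) = (\<Sum>e\<in>A. p e * \<phi> q e)"
        by (rule sum.cong) (use insert.hyps in \<open>auto simp: p'_def\<close>)
      then show ?thesis
        unfolding sum_eq by (simp add: p'_def)
    qed
    then show "\<exists>p. \<forall>q\<in>insert s Q. (\<Sum>e\<in>insert a A. p e * \<phi> q e) = f q"
      using p hQ s by (intro exI[of _ p']) (auto simp: c_def)
  qed
qed

text \<open>The exponent \<open>(i, j, k)\<close> stands for \<open>l\<^sup>i a\<^sup>j b\<^sup>k\<close> with \<open>a\<close>, \<open>b\<close> a basis of \<open>L\<close>.\<close>

type_synonym exponent = "nat \<times> nat \<times> nat"
type_synonym point = "complex \<times> complex \<times> complex"

fun wt :: "exponent \<Rightarrow> nat"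
  where "wt (i, j, k) = 2 * i + j + k"

fun monom_at :: "point \<Rightarrow> exponent \<Rightarrow> complex"
  where "monom_at (X, Y, Z) (i, j, k) = X ^ i * Y ^ j * Z ^ k"

definition low :: "exponent set"
  where "low = {e. wt e \<le> 3}"

lemma low_eq: "low = {(0,0,0), (0,0,1), (0,0,2), (0,0,3), (0,1,0), (0,1,1), (0,1,2),
    (0,2,0), (0,2,1), (0,3,0), (1,0,0), (1,0,1), (1,1,0)}"
proof -
  \<comment> \<open>A finite box containing all exponents of weight at most 3 makes the set
    computable.\<close>
  have "e \<in> low \<longleftrightarrow> e \<in> {0..1} \<times> {0..3} \<times> {0..3} \<and> wt e \<le> 3" for e
    by (cases e) (auto simp: low_def)
  then have "low = Set.filter (\<lambda>e. wt e \<le> 3) ({0..1} \<times> {0..3} \<times> {0..3})"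
    by auto
  also have "\<dots> = {(0,0,0), (0,0,1), (0,0,2), (0,0,3), (0,1,0), (0,1,1), (0,1,2),
    (0,2,0), (0,2,1), (0,3,0), (1,0,0), (1,0,1), (1,1,0)}"
    by code_simp
  finally show ?thesis .
qed

lemma finite_low: "finite low"
  by (simp add: low_eq)

lemma card_low: "card low = 13"
  by (simp add: low_eq)

lemma sum_low: "(\<Sum>e\<in>low. f e) =
    f (0,0,0) + f (0,0,1) + f (0,0,2) + f (0,0,3) + f (0,1,0) + f (0,1,1) + f (0,1,2)
    + f (0,2,0) + f (0,2,1) + f (0,3,0) + f (1,0,0) + f (1,0,1) + f (1,1,0)"
  for f :: "exponent \<Rightarrow> 'a::comm_monoid_add"
  by (simp add: low_eq add.assoc)


section \<open>Polynomials of weight at most 3 on the two model surfaces\<close>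

lemma poly_zero_punctured:
  fixes P :: "complex poly"
  assumes "\<And>y. y \<noteq> 0 \<Longrightarrow> poly P y = 0"
  shows "P = 0"
proof -
  \<comment> \<open>Multiplication by the variable adds a zero at the missing point.\<close>
  have "poly (pCons 0 P) y = 0" for y
    using assms by (cases "y = 0") auto
  then have "pCons 0 P = 0"
    using poly_all_0_iff_0 by blast
  then show ?thesis by simp
qed

lemma poly_zero:
  fixes P :: "complex poly"
  assumes "\<And>y. poly P y = 0"
  shows "P = 0"
  using assms poly_all_0_iff_0 by blast

lemma sum_low_monom_at:
  "(\<Sum>e\<in>low. p e * monom_at (x, y, z) e) =
    p (0,0,0) + p (0,0,1) * z + p (0,0,2) * z^2 + p (0,0,3) * z^3
    + y * (p (0,1,0) + p (0,1,1) * z + p (0,1,2) * z^2)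
    + y^2 * (p (0,2,0) + p (0,2,1) * z) + y^3 * p (0,3,0)
    + x * (p (1,0,0) + p (1,0,1) * z + p (1,1,0) * y)"
proof -
  have "a0 + a1 * z + a2 * z^2 + a3 * z^3 + b0 * y + b1 * (y * z) + b2 * (y * z^2)
    + c0 * y^2 + c1 * (y^2 * z) + d * y^3 + m * x + n * (x * z) + k * (x * y)
    = a0 + a1 * z + a2 * z^2 + a3 * z^3 + y * (b0 + b1 * z + b2 * z^2)
    + y^2 * (c0 + c1 * z) + y^3 * d + x * (m + n * z + k * y)"
    for a0 a1 a2 a3 b0 b1 b2 c0 c1 d m n k :: complex
    by Groebner_Basis.algebra
  then show ?thesis
    by (simp only: sum_low monom_at.simps power_0 power_one_right mult_1_left mult_1_right)
qed

text \<open>The expression is read as a polynomial in \<open>x\<close>, its coefficients as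
  polynomials in \<open>y\<close>, and theirs as polynomials in \<open>z\<close>.\<close>

lemma low_coefficients_zero:
  fixes a0 :: complex
  assumes "\<And>x y z. a0 + a1 * z + a2 * z^2 + a3 * z^3 + y * (b0 + b1 * z + b2 * z^2)
    + y^2 * (c0 + c1 * z) + y^3 * d + x * (m + n * z + k * y) = 0"
  shows "a0 = 0 \<and> a1 = 0 \<and> a2 = 0 \<and> a3 = 0 \<and> b0 = 0 \<and> b1 = 0 \<and> b2 = 0 \<and>
    c0 = 0 \<and> c1 = 0 \<and> d = 0 \<and> m = 0 \<and> n = 0 \<and> k = 0"
proof -
  have "[:a0 + a1 * z + a2 * z^2 + a3 * z^3 + y * (b0 + b1 * z + b2 * z^2)
    + y^2 * (c0 + c1 * z) + y^3 * d, m + n * z + k * y:] = 0" for y z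
    by (rule poly_zero) (use assms in simp)
  then have q: "a0 + a1 * z + a2 * z^2 + a3 * z^3 + y * (b0 + b1 * z + b2 * z^2)
      + y^2 * (c0 + c1 * z) + y^3 * d = 0"
    and m: "m + n * z + k * y = 0" for y z
    by auto
  have "[:a0 + a1 * z + a2 * z^2 + a3 * z^3, b0 + b1 * z + b2 * z^2, c0 + c1 * z, d:] = 0" for z
  proof (rule poly_zero)
    fix y
    have "poly [:a0 + a1 * z + a2 * z^2 + a3 * z^3, b0 + b1 * z + b2 * z^2, c0 + c1 * z, d:] y =
      a0 + a1 * z + a2 * z^2 + a3 * z^3 + y * (b0 + b1 * z + b2 * z^2)
      + y^2 * (c0 + c1 * z) + y^3 * d"
      by (simp only: poly_pCons poly_0) Groebner_Basis.algebra
    then show "poly [:a0 + a1 * z + a2 * z^2 + a3 * z^3, b0 + b1 * z + b2 * z^2, c0 + c1 * z, d:] y = 0"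
      unfolding q .
  qed
  then have r: "a0 + a1 * z + a2 * z^2 + a3 * z^3 = 0" "b0 + b1 * z + b2 * z^2 = 0"
    "c0 + c1 * z = 0" "d = 0" for z
    by (simp_all only: pCons_eq_0_iff)
  have "poly [:a0, a1, a2, a3:] z = a0 + a1 * z + a2 * z^2 + a3 * z^3" for z
    by (simp only: poly_pCons poly_0) Groebner_Basis.algebra
  moreover have "poly [:b0, b1, b2:] z = b0 + b1 * z + b2 * z^2" for z
    by (simp only: poly_pCons poly_0) Groebner_Basis.algebra
  moreover have "poly [:c0, c1:] z = c0 + c1 * z" for z
    by (simp only: poly_pCons poly_0) Groebner_Basis.algebra
  ultimately have "[:a0, a1, a2, a3:] = 0" "[:b0, b1, b2:] = 0" "[:c0, c1:] = 0"
    using r by (intro poly_zero; simp only:)+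
  moreover have "m = 0" "n = 0" "k = 0"
    using m[of 0 0] m[of 1 0] m[of 0 1] by auto
  ultimately show ?thesis
    using r(4) by simp
qed

text \<open>Where \<open>y\<close> is nonzero the surface is a graph over the \<open>(y, z)\<close>
  plane. Eliminating \<open>x\<close> and multiplying by \<open>y\<close> gives a polynomial in
  \<open>y\<close> whose constant term is \<open>-(1 + v3 z^3) (m + n z)\<close>. Its vanishing
  kills \<open>m\<close> and \<open>n\<close>, and then \<open>x\<close> has disappeared. The
  monomial \<open>x y\<close> is absent because subtracting a multiple of the equation removes
  it.\<close>

lemma quadric_coefficients_zero:
  fixes a0 :: complex
  assumes "\<And>x y z. 1 + v3 * z^3 + y * (v2 * z^2) + y^2 * (v1 * z) + y^3 * v0 + x * y = 0 \<Longrightarrow>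
    a0 + a1 * z + a2 * z^2 + a3 * z^3 + y * (b0 + b1 * z + b2 * z^2)
    + y^2 * (c0 + c1 * z) + y^3 * d + x * (m + n * z) = 0"
  shows "a0 = 0 \<and> a1 = 0 \<and> a2 = 0 \<and> a3 = 0 \<and> b0 = 0 \<and> b1 = 0 \<and> b2 = 0 \<and>
    c0 = 0 \<and> c1 = 0 \<and> d = 0 \<and> m = 0 \<and> n = 0"
proof -
  let ?P = "\<lambda>z. [:- (1 + v3 * z^3) * (m + n * z),
      a0 + a1 * z + a2 * z^2 + a3 * z^3 - v2 * z^2 * (m + n * z),
      b0 + b1 * z + b2 * z^2 - v1 * z * (m + n * z),
      c0 + c1 * z - v0 * (m + n * z), d:]"
  have "?P z = 0" for z
  proof (rule poly_zero_punctured)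
    fix y :: complex assume y: "y \<noteq> 0"
    define x where "x = - (1 + v3 * z^3 + y * (v2 * z^2) + y^2 * (v1 * z) + y^3 * v0) / y"
    have xy: "x * y = - (1 + v3 * z^3 + y * (v2 * z^2) + y^2 * (v1 * z) + y^3 * v0)"
      using y by (simp add: x_def)
    have "1 + v3 * z^3 + y * (v2 * z^2) + y^2 * (v1 * z) + y^3 * v0 + x * y = 0"
      unfolding xy by simp
    then have zero: "a0 + a1 * z + a2 * z^2 + a3 * z^3 + y * (b0 + b1 * z + b2 * z^2)
      + y^2 * (c0 + c1 * z) + y^3 * d + x * (m + n * z) = 0"
      by (rule assms)
    have "poly (?P z) y = y * (a0 + a1 * z + a2 * z^2 + a3 * z^3 + y * (b0 + b1 * z + b2 * z^2)
      + y^2 * (c0 + c1 * z) + y^3 * d)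
      + (- (1 + v3 * z^3 + y * (v2 * z^2) + y^2 * (v1 * z) + y^3 * v0)) * (m + n * z)"
      by (simp only: poly_pCons poly_0) Groebner_Basis.algebra
    also have "\<dots> = y * (a0 + a1 * z + a2 * z^2 + a3 * z^3 + y * (b0 + b1 * z + b2 * z^2)
      + y^2 * (c0 + c1 * z) + y^3 * d + x * (m + n * z))"
      unfolding xy[symmetric] by Groebner_Basis.algebra
    finally show "poly (?P z) y = 0"
      unfolding zero by simp
  qed
  then have r: "- (1 + v3 * z^3) * (m + n * z) = 0"
      "a0 + a1 * z + a2 * z^2 + a3 * z^3 - v2 * z^2 * (m + n * z) = 0"
      "b0 + b1 * z + b2 * z^2 - v1 * z * (m + n * z) = 0"
      "c0 + c1 * z - v0 * (m + n * z) = 0" "d = 0" for z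
    by (simp_all only: pCons_eq_0_iff)
  \<comment> \<open>In the expansion of \<open>(1 + v3 z^3) (m + n z)\<close> the two lowest
    coefficients are \<open>m\<close> and \<open>n\<close>, whatever \<open>v3\<close> is.\<close>
  have "poly [:m, n, 0, v3 * m, v3 * n:] z = 0" for z
  proof -
    have "poly [:m, n, 0, v3 * m, v3 * n:] z = - (- (1 + v3 * z^3) * (m + n * z))"
      by (simp only: poly_pCons poly_0) Groebner_Basis.algebra
    then show ?thesis unfolding r by simp
  qed
  then have mn: "m = 0" "n = 0"
    using poly_zero[of "[:m, n, 0, v3 * m, v3 * n:]"] by auto
  have "a0 + a1 * z + a2 * z^2 + a3 * z^3 + y * (b0 + b1 * z + b2 * z^2)
    + y^2 * (c0 + c1 * z) + y^3 * d + x * (0 + 0 * z + 0 * y) = 0" for x y z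
  proof -
    have "a0 + a1 * z + a2 * z^2 + a3 * z^3 = 0" "b0 + b1 * z + b2 * z^2 = 0" "c0 + c1 * z = 0"
      using r(2-4)[of z] mn by simp_all
    with r(5) show ?thesis by simp
  qed
  from low_coefficients_zero[OF this] mn show ?thesis by simp
qed

text \<open>Substituting \<open>x = -c(y, z)\<close>, with \<open>c\<close> the cubic form with
  coefficients \<open>v0\<close>, ..., \<open>v3\<close>, and sorting by degree shows that the cubic
  part equals \<open>m c\<close>, that \<open>(n z + k y) c = 0\<close>, and that the terms of lower
  degree vanish.\<close>

lemma graph_coefficients_zero:
  fixes a0 :: complex
  assumes "\<And>x y z. v3 * z^3 + y * (v2 * z^2) + y^2 * (v1 * z) + y^3 * v0 + x = 0 \<Longrightarrow>
    a0 + a1 * z + a2 * z^2 + a3 * z^3 + y * (b0 + b1 * z + b2 * z^2)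
    + y^2 * (c0 + c1 * z) + y^3 * d + x * (m + n * z + k * y) = 0"
    and v: "v3 \<noteq> 0 \<and> a3 = 0 \<or> v2 \<noteq> 0 \<and> b2 = 0 \<or> v1 \<noteq> 0 \<and> c1 = 0 \<or> v0 \<noteq> 0 \<and> d = 0"
  shows "a0 = 0 \<and> a1 = 0 \<and> a2 = 0 \<and> a3 = 0 \<and> b0 = 0 \<and> b1 = 0 \<and> b2 = 0 \<and>
    c0 = 0 \<and> c1 = 0 \<and> d = 0 \<and> m = 0 \<and> n = 0 \<and> k = 0"
proof -
  let ?P = "\<lambda>z. [:a0 + a1 * z + a2 * z^2 + a3 * z^3 - v3 * z^3 * (m + n * z),
      b0 + b1 * z + b2 * z^2 - v2 * z^2 * (m + n * z) - v3 * z^3 * k,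
      c0 + c1 * z - v1 * z * (m + n * z) - v2 * z^2 * k,
      d - v0 * (m + n * z) - v1 * z * k, - (v0 * k):]"
  have "?P z = 0" for z
  proof (rule poly_zero)
    fix y :: complex
    define x where "x = - (v3 * z^3 + y * (v2 * z^2) + y^2 * (v1 * z) + y^3 * v0)"
    have zero: "a0 + a1 * z + a2 * z^2 + a3 * z^3 + y * (b0 + b1 * z + b2 * z^2)
      + y^2 * (c0 + c1 * z) + y^3 * d + x * (m + n * z + k * y) = 0"
      by (rule assms(1)) (simp add: x_def)
    have "poly (?P z) y = a0 + a1 * z + a2 * z^2 + a3 * z^3 + y * (b0 + b1 * z + b2 * z^2)
      + y^2 * (c0 + c1 * z) + y^3 * d + x * (m + n * z + k * y)"
      unfolding x_def by (simp only: poly_pCons poly_0) Groebner_Basis.algebra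
    then show "poly (?P z) y = 0"
      unfolding zero .
  qed
  then have r: "a0 + a1 * z + a2 * z^2 + a3 * z^3 - v3 * z^3 * (m + n * z) = 0"
      "b0 + b1 * z + b2 * z^2 - v2 * z^2 * (m + n * z) - v3 * z^3 * k = 0"
      "c0 + c1 * z - v1 * z * (m + n * z) - v2 * z^2 * k = 0"
      "d - v0 * (m + n * z) - v1 * z * k = 0" "v0 * k = 0" for z
    by (simp_all only: pCons_eq_0_iff neg_equal_0_iff_equal)
  have "poly [:a0, a1, a2, a3 - v3 * m, - (v3 * n):] z = 0" for z
  proof -
    have "poly [:a0, a1, a2, a3 - v3 * m, - (v3 * n):] z =
      a0 + a1 * z + a2 * z^2 + a3 * z^3 - v3 * z^3 * (m + n * z)"
      by (simp only: poly_pCons poly_0) Groebner_Basis.algebra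
    then show ?thesis unfolding r .
  qed
  from poly_zero[OF this]
  have s1: "a0 = 0" "a1 = 0" "a2 = 0" "a3 = v3 * m" "v3 * n = 0"
    by (simp_all only: pCons_eq_0_iff neg_equal_0_iff_equal right_minus_eq)
  have "poly [:b0, b1, b2 - v2 * m, - (v2 * n + v3 * k):] z = 0" for z
  proof -
    have "poly [:b0, b1, b2 - v2 * m, - (v2 * n + v3 * k):] z =
      b0 + b1 * z + b2 * z^2 - v2 * z^2 * (m + n * z) - v3 * z^3 * k"
      by (simp only: poly_pCons poly_0) Groebner_Basis.algebra
    then show ?thesis unfolding r .
  qed
  from poly_zero[OF this]
  have s2: "b0 = 0" "b1 = 0" "b2 = v2 * m" "v2 * n + v3 * k = 0"
    by (simp_all only: pCons_eq_0_iff neg_equal_0_iff_equal right_minus_eq)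
  have "poly [:c0, c1 - v1 * m, - (v1 * n + v2 * k):] z = 0" for z
  proof -
    have "poly [:c0, c1 - v1 * m, - (v1 * n + v2 * k):] z =
      c0 + c1 * z - v1 * z * (m + n * z) - v2 * z^2 * k"
      by (simp only: poly_pCons poly_0) Groebner_Basis.algebra
    then show ?thesis unfolding r .
  qed
  from poly_zero[OF this]
  have s3: "c0 = 0" "c1 = v1 * m" "v1 * n + v2 * k = 0"
    by (simp_all only: pCons_eq_0_iff neg_equal_0_iff_equal right_minus_eq)
  have "poly [:d - v0 * m, - (v0 * n + v1 * k):] z = 0" for z
  proof -
    have "poly [:d - v0 * m, - (v0 * n + v1 * k):] z = d - v0 * (m + n * z) - v1 * z * k"
      by (simp only: poly_pCons poly_0) Groebner_Basis.algebra
    then show ?thesis unfolding r .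
  qed
  from poly_zero[OF this]
  have s4: "d = v0 * m" "v0 * n + v1 * k = 0"
    by (simp_all only: pCons_eq_0_iff neg_equal_0_iff_equal right_minus_eq)
  \<comment> \<open>One coefficient of \<open>m c\<close> is zero although the corresponding
    coefficient of \<open>c\<close> is not.\<close>
  have "m = 0"
    using v s1(4) s2(3) s3(2) s4(1) by auto
  \<comment> \<open>The remaining relations are the coefficients of the quartic form
    \<open>(n z + k y) c(y, z)\<close>, with \<open>c\<close> nonzero.\<close>
  moreover have "n = 0"
    using v s1(5) s2(4) s3(3) s4(2) by auto
  moreover from this have "k = 0"
    using v s2(4) s3(3) s4(2) r(5) by auto
  ultimately show ?thesis
    using s1 s2 s3 s4 by simp
qed

lemma low_monomials_independent:
  assumes "\<And>q. (\<Sum>e\<in>low. p e * monom_at q e) = 0"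
  shows "\<forall>e\<in>low. p e = 0"
proof -
  have "(\<Sum>e\<in>low. p e * monom_at (x, y, z) e) = 0" for x y z
    by (rule assms)
  from low_coefficients_zero[OF this[unfolded sum_low_monom_at]] show ?thesis
    unfolding low_eq by blast
qed

definition vanishes_on_surface :: "(exponent \<Rightarrow> complex) \<Rightarrow> (exponent \<Rightarrow> complex) \<Rightarrow> bool"
  where "vanishes_on_surface V p \<longleftrightarrow>
    (\<forall>q. (\<Sum>e\<in>low. V e * monom_at q e) = 0 \<longrightarrow> (\<Sum>e\<in>low. p e * monom_at q e) = 0)"

text \<open>Here \<open>V = 1 + xy + c(y, z)\<close> with \<open>c\<close> a cubic form. The constant term makes the numerator of
  \<open>x = -(1 + c) / y\<close> nonzero at \<open>y = z = 0\<close>; without it \<open>V\<close> could be divisible by \<open>y\<close>, and the part \<open>y = 0\<close>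
  of the surface would be missed.\<close>

lemma quadric_surface:
  assumes V: "V (0,0,0) = 1" "V (0,0,1) = 0" "V (0,0,2) = 0" "V (0,1,0) = 0" "V (0,1,1) = 0"
      "V (0,2,0) = 0" "V (1,0,0) = 0" "V (1,0,1) = 0" "V (1,1,0) = 1"
    and p: "vanishes_on_surface V p" "p (1,1,0) = 0"
  shows "\<forall>e\<in>low. p e = 0"
proof -
  have "p (0,0,0) + p (0,0,1) * z + p (0,0,2) * z^2 + p (0,0,3) * z^3
    + y * (p (0,1,0) + p (0,1,1) * z + p (0,1,2) * z^2)
    + y^2 * (p (0,2,0) + p (0,2,1) * z) + y^3 * p (0,3,0)
    + x * (p (1,0,0) + p (1,0,1) * z) = 0"
    if "1 + V (0,0,3) * z^3 + y * (V (0,1,2) * z^2) + y^2 * (V (0,2,1) * z) + y^3 * V (0,3,0) + x * y = 0"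
    for x y z
  proof -
    have "(\<Sum>e\<in>low. V e * monom_at (x, y, z) e) = 0"
      unfolding sum_low_monom_at V using that by simp
    then have "(\<Sum>e\<in>low. p e * monom_at (x, y, z) e) = 0"
      using p(1) unfolding vanishes_on_surface_def by blast
    then show ?thesis
      unfolding sum_low_monom_at p(2) by simp
  qed
  from quadric_coefficients_zero[OF this] p(2) show ?thesis
    unfolding low_eq by blast
qed

text \<open>Here \<open>V = x + c(y, z)\<close> with \<open>c\<close> a nonzero cubic form, so the
  whole surface is a graph over the \<open>(y, z)\<close> plane. The condition at \<open>e0\<close>
  rules out nonzero multiples of \<open>V\<close>.\<close>

lemma cubic_graph:
  assumes V: "V (0,0,0) = 0" "V (0,0,1) = 0" "V (0,0,2) = 0" "V (0,1,0) = 0" "V (0,1,1) = 0"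
      "V (0,2,0) = 0" "V (1,0,0) = 1" "V (1,0,1) = 0" "V (1,1,0) = 0"
    and e0: "e0 \<in> {(0,0,3), (0,1,2), (0,2,1), (0,3,0)}" "V e0 \<noteq> 0"
    and p: "vanishes_on_surface V p" "p e0 = 0"
  shows "\<forall>e\<in>low. p e = 0"
proof -
  have "p (0,0,0) + p (0,0,1) * z + p (0,0,2) * z^2 + p (0,0,3) * z^3
    + y * (p (0,1,0) + p (0,1,1) * z + p (0,1,2) * z^2)
    + y^2 * (p (0,2,0) + p (0,2,1) * z) + y^3 * p (0,3,0)
    + x * (p (1,0,0) + p (1,0,1) * z + p (1,1,0) * y) = 0"
    if "V (0,0,3) * z^3 + y * (V (0,1,2) * z^2) + y^2 * (V (0,2,1) * z) + y^3 * V (0,3,0) + x = 0"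
    for x y z
  proof -
    have "(\<Sum>e\<in>low. V e * monom_at (x, y, z) e) = 0"
      unfolding sum_low_monom_at V using that by simp
    then have "(\<Sum>e\<in>low. p e * monom_at (x, y, z) e) = 0"
      using p(1) unfolding vanishes_on_surface_def by blast
    then show ?thesis
      unfolding sum_low_monom_at .
  qed
  from graph_coefficients_zero[OF this] e0 p(2) show ?thesis
    unfolding low_eq by blast
qed

section \<open>The weight filtration\<close>

definition csubst :: "('v::finite \<Rightarrow> complex poly) \<Rightarrow> 'v cpoly \<Rightarrow> complex poly"
  where "csubst h p = (\<Sum>m\<in>Poly_Mapping.keys p.
    Polynomial.smult (Poly_Mapping.lookup p m) (\<Prod>i\<in>UNIV. h i ^ Poly_Mapping.lookup m i))"

lemma csubst_superset:
  assumes "finite S" "Poly_Mapping.keys p \<subseteq> S"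
  shows "csubst h p = (\<Sum>m\<in>S.
    Polynomial.smult (Poly_Mapping.lookup p m) (\<Prod>i\<in>UNIV. h i ^ Poly_Mapping.lookup m i))"
  unfolding csubst_def using assms
  by (intro sum.mono_neutral_left) (auto simp: in_keys_iff)

lemma csubst_add: "csubst h (p + q) = csubst h p + csubst h q"
proof -
  let ?S = "Poly_Mapping.keys p \<union> Poly_Mapping.keys q"
  have "csubst h (p + q) = (\<Sum>m\<in>?S. Polynomial.smult (Poly_Mapping.lookup (p + q) m)
      (\<Prod>i\<in>UNIV. h i ^ Poly_Mapping.lookup m i))"
    using keys_add[of p q] by (intro csubst_superset) auto
  then show ?thesis
    by (simp add: lookup_add smult_add_left sum.distrib csubst_superset[of ?S])
qed

lemma csubst_single:
  "csubst h (Poly_Mapping.single m c) = Polynomial.smult c (\<Prod>i\<in>UNIV. h i ^ Poly_Mapping.lookup m i)"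
  by (simp add: csubst_def)

lemma csubst_0: "csubst h 0 = 0"
  by (simp add: csubst_def)

lemma csubst_sum: "csubst h (sum f A) = (\<Sum>x\<in>A. csubst h (f x))"
  by (induction A rule: infinite_finite_induct) (simp_all add: csubst_0 csubst_add)

lemma cpoly_sum_monomials:
  "p = (\<Sum>m\<in>Poly_Mapping.keys p. Poly_Mapping.single m (Poly_Mapping.lookup p m))"
  for p :: "'v cpoly"
proof (rule poly_mapping_eqI)
  fix m
  show "Poly_Mapping.lookup p m = Poly_Mapping.lookup
    (\<Sum>m\<in>Poly_Mapping.keys p. Poly_Mapping.single m (Poly_Mapping.lookup p m)) m"
    by (auto simp: lookup_sum lookup_single when_def in_keys_iff)
qed

text \<open>Both sides are additive in each factor, and on monomials the exponents add.\<close>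

lemma csubst_mult: "csubst h (p * q) = csubst h p * csubst h q"
proof -
  have single: "csubst h (Poly_Mapping.single m c * Poly_Mapping.single n d) =
      csubst h (Poly_Mapping.single m c) * csubst h (Poly_Mapping.single n d)" for m n c d
    by (simp add: mult_single csubst_single lookup_add power_add prod.distrib mult.commute[of c d])
  have "csubst h (p * q) = csubst h
    ((\<Sum>m\<in>Poly_Mapping.keys p. Poly_Mapping.single m (Poly_Mapping.lookup p m)) *
     (\<Sum>n\<in>Poly_Mapping.keys q. Poly_Mapping.single n (Poly_Mapping.lookup q n)))"
    by (simp flip: cpoly_sum_monomials)
  also have "\<dots> = csubst h (\<Sum>m\<in>Poly_Mapping.keys p. Poly_Mapping.single m (Poly_Mapping.lookup p m)) *
    csubst h (\<Sum>n\<in>Poly_Mapping.keys q. Poly_Mapping.single n (Poly_Mapping.lookup q n))"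
    by (simp add: sum_product csubst_sum single)
  also have "\<dots> = csubst h p * csubst h q"
    by (simp flip: cpoly_sum_monomials)
  finally show ?thesis .
qed

lemma csubst_cscale: "csubst h (cscale c p) = Polynomial.smult c (csubst h p)"
  by (simp add: cscale_def cconst_def csubst_mult csubst_single)

lemma csubst_1: "csubst h 1 = 1"
  using csubst_single[of h 0 1] by simp

lemma csubst_cvar: "csubst h (cvar i) = h i"
proof -
  have "(\<Prod>j\<in>UNIV. h j ^ Poly_Mapping.lookup (Poly_Mapping.single i 1) j) = (\<Prod>j\<in>UNIV. if j = i then h j else 1)"
    by (rule prod.cong) (auto simp: lookup_single when_def)
  then show ?thesis
    by (simp add: cvar_def csubst_single)
qed

lemma single_eq_monomial:
  "Poly_Mapping.single m c = cscale c (\<Prod>i\<in>UNIV. cvar i ^ Poly_Mapping.lookup m i)"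
  for m :: "'v::finite \<Rightarrow>\<^sub>0 nat"
proof -
  have power: "cvar i ^ n = Poly_Mapping.single (Poly_Mapping.single i n) 1" for i :: 'v and n
    by (induction n) (simp_all add: cvar_def mult_single flip: single_add)
  have "(\<Prod>i\<in>S. cvar i ^ Poly_Mapping.lookup m i) =
      Poly_Mapping.single (\<Sum>i\<in>S. Poly_Mapping.single i (Poly_Mapping.lookup m i)) 1" if "finite S" for S
    using that by induction (simp_all add: power mult_single)
  moreover have "(\<Sum>i\<in>UNIV. Poly_Mapping.single i (Poly_Mapping.lookup m i)) = m"
    by (rule poly_mapping_eqI) (simp add: lookup_sum lookup_single when_def)
  ultimately show ?thesis
    by (simp add: cscale_def cconst_def mult_single)
qed

fun cmon :: "'v cpoly \<Rightarrow> 'v cpoly \<Rightarrow> 'v cpoly \<Rightarrow> exponent \<Rightarrow> 'v cpoly"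
  where "cmon l a b (i, j, k) = l ^ i * a ^ j * b ^ k"

text \<open>\<open>\<Theta> (X, Y, Z) f\<close> is the restriction of \<open>f\<close> to the curve on which \<open>(l, a, b) = (s\<^sup>2 X, s Y, s Z)\<close>, as a
  polynomial in \<open>s\<close>: its \<open>n\<close>-th coefficient is the value at \<open>(X, Y, Z)\<close> of the part of weight \<open>n\<close> of \<open>f\<close>.\<close>

locale weighted_coords =
  fixes l a b :: "'v::finite cpoly" and \<Theta> :: "point \<Rightarrow> 'v cpoly \<Rightarrow> complex poly"
  assumes \<Theta>_add: "\<Theta> q (f + g) = \<Theta> q f + \<Theta> q g"
    and \<Theta>_mult: "\<Theta> q (f * g) = \<Theta> q f * \<Theta> q g"
    and \<Theta>_cscale: "\<Theta> q (cscale c f) = Polynomial.smult c (\<Theta> q f)"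
    and \<Theta>_1: "\<Theta> q 1 = 1"
    and \<Theta>_l: "\<Theta> (X, Y, Z) l = Polynomial.monom X 2"
    and \<Theta>_a: "\<Theta> (X, Y, Z) a = Polynomial.monom Y 1"
    and \<Theta>_b: "\<Theta> (X, Y, Z) b = Polynomial.monom Z 1"
    and forms: "{l, a, b} \<subseteq> cvec.span (range cvar)"
    and vars: "range cvar \<subseteq> cvec.span {l, a, b}"
begin

abbreviation mon :: "exponent \<Rightarrow> 'v cpoly"
  where "mon \<equiv> cmon l a b"

lemma \<Theta>_0: "\<Theta> q 0 = 0"
  using \<Theta>_cscale[of q 0 0] by simp

lemma \<Theta>_sum: "\<Theta> q (sum f A) = (\<Sum>x\<in>A. \<Theta> q (f x))"
  by (induction A rule: infinite_finite_induct) (simp_all add: \<Theta>_0 \<Theta>_add)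

lemma \<Theta>_diff: "\<Theta> q (f - g) = \<Theta> q f - \<Theta> q g"
  using \<Theta>_add[of q "f - g" g] by simp

lemma \<Theta>_power: "\<Theta> q (f ^ n) = \<Theta> q f ^ n"
  by (induction n) (simp_all add: \<Theta>_1 \<Theta>_mult)

lemma \<Theta>_mon: "\<Theta> q (mon e) = Polynomial.monom (monom_at q e) (wt e)"
  by (cases q; cases e)
    (simp only: cmon.simps monom_at.simps wt.simps \<Theta>_mult \<Theta>_power \<Theta>_l \<Theta>_a \<Theta>_b
      monom_power mult_monom mult_1 add.assoc mult.assoc)

text \<open>The span contains 1 and is stable under multiplication by \<open>l\<close>,
  \<open>a\<close> and \<open>b\<close>, hence by every combination of them, and in particular by
  every variable.\<close>

lemma span_cmon: "cvec.span (range mon) = UNIV"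
proof -
  let ?T = "cvec.span (range mon)"
  have gen: "x * f \<in> ?T" if x: "x \<in> {l, a, b}" and f: "f \<in> ?T" for x f
    using f
  proof (induction rule: cvec.span_induct_alt)
    case base
    show ?case by (simp add: cvec.span_zero)
  next
    case (step c m f)
    then obtain i j k where m: "m = mon (i, j, k)" by auto
    have ac: "x * (p * q * r) = x * p * q * r" "x * (p * q * r) = p * (x * q) * r"
      "x * (p * q * r) = p * q * (x * r)" for x p q r :: "'v cpoly"
      by (simp_all only: mult.assoc mult.left_commute)
    have "l * m = mon (Suc i, j, k)" "a * m = mon (i, Suc j, k)" "b * m = mon (i, j, Suc k)"
      unfolding m cmon.simps power_Suc by (rule ac)+
    then have "x * m \<in> range mon"
      using x by (auto simp del: cmon.simps)
    then have "cscale c (x * m) + x * f \<in> ?T"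
      by (rule cvec.span_add[OF cvec.span_scale[OF cvec.span_base] step.IH])
    also have "cscale c (x * m) + x * f = x * (cscale c m + f)"
      by (simp only: cscale_def distrib_left mult.left_commute)
    finally show ?case .
  qed
  have lin: "u * f \<in> ?T" if u: "u \<in> cvec.span {l, a, b}" and f: "f \<in> ?T" for u f
    using u
  proof (induction rule: cvec.span_induct_alt)
    case base
    show ?case by (simp add: cvec.span_zero)
  next
    case (step c x y)
    then have "cscale c (x * f) + y * f \<in> ?T"
      using gen[OF _ f] by (intro cvec.span_add cvec.span_scale) auto
    also have "cscale c (x * f) + y * f = (cscale c x + y) * f"
      by (simp only: cscale_def distrib_right mult.assoc)
    finally show ?case .
  qed
  have var: "cvar i * f \<in> ?T" if "f \<in> ?T" for i f
    using lin vars that by blast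
  have power: "cvar i ^ n * f \<in> ?T" if "f \<in> ?T" for i n f
    using that by (induction n) (simp_all add: var mult.assoc del: ideal.scale_scale)
  have one: "1 \<in> ?T"
  proof -
    have "mon (0, 0, 0) \<in> ?T" by (rule cvec.span_base) (rule rangeI)
    then show ?thesis by simp
  qed
  have "(\<Prod>i\<in>S. cvar i ^ n i) \<in> ?T" if "finite S" for S n
    using that by induction (simp_all add: one power)
  then have "Poly_Mapping.single m c \<in> ?T" for m c
    unfolding single_eq_monomial by (intro cvec.span_scale) simp
  then have "f \<in> ?T" for f
    by (subst cpoly_sum_monomials) (intro cvec.span_sum)
  then show ?thesis by blast
qed

text \<open>The only monomial in \<open>l\<close>, \<open>a\<close>, \<open>b\<close> of weight 0 is
  1, whose value is the same at all points.\<close>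

lemma constant_coeff: "\<exists>k. \<forall>q. coeff (\<Theta> q f) 0 = k"
proof -
  have "f \<in> cvec.span (range mon)"
    by (simp add: span_cmon)
  then show ?thesis
  proof (induction rule: cvec.span_induct_alt)
    case base
    show ?case by (simp add: \<Theta>_0)
  next
    case (step c m f)
    then obtain i j k where m: "m = mon (i, j, k)" by auto
    from step obtain r where r: "\<And>q. coeff (\<Theta> q f) 0 = r" by blast
    have "coeff (\<Theta> q m) 0 = (if wt (i, j, k) = 0 then 1 else 0)" for q
      unfolding m \<Theta>_mon by (cases q) simp
    then show ?case
      using r by (auto simp: \<Theta>_add \<Theta>_cscale)
  qed
qed

lemma \<Theta>_eq_0_ideal: "ideal.subspace {f. \<forall>q\<in>Q. poly (\<Theta> q f) t = 0}"
  by (rule ideal.subspaceI) (simp_all add: \<Theta>_0 \<Theta>_add \<Theta>_mult)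

lemma coeff_sum_mon:
  assumes "finite B"
  shows "coeff (\<Theta> q (\<Sum>e\<in>B. cscale (c e) (mon e))) n = (\<Sum>e\<in>{e\<in>B. wt e = n}. c e * monom_at q e)"
proof -
  have "coeff (\<Theta> q (\<Sum>e\<in>B. cscale (c e) (mon e))) n =
      (\<Sum>e\<in>B. if wt e = n then c e * monom_at q e else 0)"
    by (auto simp: \<Theta>_sum \<Theta>_cscale \<Theta>_mon coeff_sum intro!: sum.cong)
  then show ?thesis
    using assms by (simp add: sum.inter_filter)
qed

text \<open>Evaluating at \<open>t\<close> amounts to evaluating at the scaled point
  \<open>(t^2 X, t Y, t Z)\<close>, which multiplies a monomial of weight \<open>n\<close> by
  \<open>t^n\<close>.\<close>

lemma eval_sum_mon:
  "poly (\<Theta> q (\<Sum>e\<in>B. cscale (c e) (mon e))) t = (\<Sum>e\<in>B. c e * t ^ wt e * monom_at q e)"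
  by (auto simp: \<Theta>_sum \<Theta>_cscale \<Theta>_mon poly_sum poly_monom intro!: sum.cong)

lemma sum_by_weight:
  "(\<Sum>e\<in>B. f e) = (\<Sum>n\<le>3. \<Sum>e\<in>{e\<in>B. wt e = n}. f e)" if "B \<subseteq> low" for f :: "exponent \<Rightarrow> complex"
proof -
  have fin: "finite B" using that finite_low finite_subset by blast
  have "(\<Sum>e\<in>B. f e) = (\<Sum>n\<in>{..3}. sum f {e \<in> B. wt e = n})"
    by (rule sum.group[symmetric]) (use that fin in \<open>auto simp: low_def\<close>)
  then show ?thesis .
qed

text \<open>The path runs from \<open>K 0 = I\<close> through the ideals \<open>K t\<close> of the
  scaled points, and the monomials with exponent in \<open>low - {e0}\<close> are a basis of every
  quotient. The assumption \<open>initial\<close> says that below weight 4 an element of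
  \<open>I\<close> is a multiple of the leading form of \<open>V\<close>; it gives independence at
  \<open>t = 0\<close>. Continuity of coordinates is linear in the polynomial and so is checked on
  monomials.\<close>

lemma smoothable_initial:
  assumes ideal: "ideal.subspace I"
    and e0: "e0 \<in> low" "wt e0 = 3" "V e0 \<noteq> 0"
    and surface: "\<And>p. vanishes_on_surface V p \<Longrightarrow> p e0 = 0 \<Longrightarrow> \<forall>e\<in>low. p e = 0"
    and v: "(\<Sum>e\<in>{e\<in>low. wt e = 3}. cscale (V e) (mon e)) \<in> I"
    and high: "\<And>e. wt e \<ge> 4 \<Longrightarrow> mon e \<in> I"
    and initial: "\<And>f. f \<in> I \<Longrightarrow> \<exists>k. \<forall>q. \<forall>n\<le>3. coeff (\<Theta> q f) n =
      (if n = 3 then k * (\<Sum>e\<in>{e\<in>low. wt e = 3}. V e * monom_at q e) else 0)"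
  shows "I \<in> Hilb 12 \<and> I \<in> smoothable_component 12"
proof -
  define B where "B = low - {e0}"
  define S where "S = {q. (\<Sum>e\<in>low. V e * monom_at q e) = 0}"
  have B: "finite B" "card B = 12" "e0 \<notin> B" "insert e0 B = low" "B \<subseteq> low"
    using e0 finite_low card_low by (auto simp: B_def)
  have sum_low_B: "(\<Sum>e\<in>low. f e) = f e0 + (\<Sum>e\<in>B. f e)" for f :: "exponent \<Rightarrow> complex"
    using B by (metis sum.insert)
  \<comment> \<open>A polynomial supported on \<open>B\<close> has coefficient 0 at
    \<open>e0\<close>, so it cannot vanish on the surface unless it is zero.\<close>
  have restr: "\<forall>e\<in>B. p e = 0" if p: "\<And>q. q \<in> S \<Longrightarrow> (\<Sum>e\<in>B. p e * monom_at q e) = 0" for p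
  proof -
    let ?p = "p(e0 := 0)"
    have "(\<Sum>e\<in>low. ?p e * monom_at q e) = (\<Sum>e\<in>B. p e * monom_at q e)" for q
      unfolding sum_low_B using B(3) by (auto intro!: sum.cong)
    then have "vanishes_on_surface V ?p"
      using p by (simp add: vanishes_on_surface_def S_def)
    from surface[OF this] B show ?thesis by (auto split: if_splits)
  qed
  from interpolation_points[where S = S and \<phi> = monom_at, OF B(1) restr] obtain Q where Q: "Q \<subseteq> S" "finite Q" "card Q = 12"
    and uniq: "\<And>p. (\<forall>q\<in>Q. (\<Sum>e\<in>B. p e * monom_at q e) = 0) \<longrightarrow> (\<forall>e\<in>B. p e = 0)"
    and interp: "\<And>f. \<exists>p. \<forall>q\<in>Q. (\<Sum>e\<in>B. p e * monom_at q e) = f q"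
    unfolding B(2) by auto
  define K where "K t = (if t = 0 then I else {f. \<forall>q\<in>Q. poly (\<Theta> q f) t = 0})" for t
  have K_ideal: "ideal.subspace (K t)" for t
    using ideal \<Theta>_eq_0_ideal by (simp add: K_def)
  have K_indep: "\<forall>e\<in>B. c e = 0" if c: "(\<Sum>e\<in>B. cscale (c e) (mon e)) \<in> K t" for c t
  proof (cases "t = 0")
    case False
    then have "\<forall>q\<in>Q. (\<Sum>e\<in>B. (c e * t ^ wt e) * monom_at q e) = 0"
      using c by (simp add: K_def eval_sum_mon)
    with uniq[of "\<lambda>e. c e * t ^ wt e"] have "\<forall>e\<in>B. c e * t ^ wt e = 0"
      by simp
    with False show ?thesis by simp
  next
    case True
    with c have "(\<Sum>e\<in>B. cscale (c e) (mon e)) \<in> I"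
      by (simp add: K_def)
    from initial[OF this] obtain k where k: "\<And>q n. n \<le> 3 \<Longrightarrow>
        (\<Sum>e\<in>{e\<in>B. wt e = n}. c e * monom_at q e) =
        (if n = 3 then k * (\<Sum>e\<in>{e\<in>low. wt e = 3}. V e * monom_at q e) else 0)"
      unfolding coeff_sum_mon[OF B(1)] by auto
    \<comment> \<open>The difference between the given combination and \<open>k\<close> times the
      leading form vanishes at every point, hence has zero coefficients. At \<open>e0\<close> its
      coefficient is \<open>-k * V e0\<close>, which forces \<open>k = 0\<close>.\<close>
    let ?p = "\<lambda>e. (if e = e0 then 0 else c e) - (if wt e = 3 then k * V e else 0)"
    have "(\<Sum>e\<in>low. ?p e * monom_at q e) = 0" for q
    proof -
      have "(\<Sum>e\<in>low. ?p e * monom_at q e) = (\<Sum>e\<in>low. (if e = e0 then 0 else c e) * monom_at q e)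
        - (\<Sum>e\<in>low. (if wt e = 3 then k * V e else 0) * monom_at q e)"
        by (simp only: left_diff_distrib sum_subtractf)
      also have "(\<Sum>e\<in>low. (if e = e0 then 0 else c e) * monom_at q e) =
          (\<Sum>e\<in>B. c e * monom_at q e)"
        unfolding sum_low_B using B(3) by (auto intro!: sum.cong)
      also have "\<dots> = (\<Sum>n\<le>3. \<Sum>e\<in>{e\<in>B. wt e = n}. c e * monom_at q e)"
        using B(5) by (rule sum_by_weight)
      also have "\<dots> = (\<Sum>n\<le>3::nat. if n = 3 then k * (\<Sum>e\<in>{e\<in>low. wt e = 3}. V e * monom_at q e) else 0)"
        by (rule sum.cong) (use k in auto)
      also have "\<dots> = k * (\<Sum>e\<in>{e\<in>low. wt e = 3}. V e * monom_at q e)"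
        by simp
      also have "(\<Sum>e\<in>low. (if wt e = 3 then k * V e else 0) * monom_at q e) =
          (\<Sum>e\<in>{e\<in>low. wt e = 3}. k * V e * monom_at q e)"
        unfolding sum.inter_filter[OF finite_low] by (rule sum.cong) auto
      also have "\<dots> = k * (\<Sum>e\<in>{e\<in>low. wt e = 3}. V e * monom_at q e)"
        by (simp only: sum_distrib_left mult.assoc)
      finally show ?thesis by simp
    qed
    then have p: "\<forall>e\<in>low. ?p e = 0"
      by (rule low_monomials_independent)
    with e0 have "k = 0" by auto
    show ?thesis
    proof
      fix e assume "e \<in> B"
      then have "?p e = 0" "e \<noteq> e0" using p B(3,5) by blast+
      with \<open>k = 0\<close> show "c e = 0" by simp
    qed
  qed
  let ?G = "{f. \<exists>C. (\<forall>t. f - (\<Sum>e\<in>B. cscale (C t e) (mon e)) \<in> K t) \<and>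
      (\<forall>e\<in>B. isCont (\<lambda>t. C t e) 0)}"
  have G_subspace: "cvec.subspace ?G"
  proof (rule cvec.subspaceI)
    show "0 \<in> ?G"
      using ideal.subspace_0[OF K_ideal] by (auto intro!: exI[of _ "\<lambda>t e. 0"])
  next
    fix f g assume "f \<in> ?G" "g \<in> ?G"
    then obtain C D where C: "\<forall>t. f - (\<Sum>e\<in>B. cscale (C t e) (mon e)) \<in> K t"
        "\<forall>e\<in>B. isCont (\<lambda>t. C t e) 0"
      and D: "\<forall>t. g - (\<Sum>e\<in>B. cscale (D t e) (mon e)) \<in> K t"
        "\<forall>e\<in>B. isCont (\<lambda>t. D t e) 0"
      by auto
    have "f + g - (\<Sum>e\<in>B. cscale (C t e + D t e) (mon e)) \<in> K t" for t
      using ideal.subspace_add[OF K_ideal C(1)[rule_format] D(1)[rule_format], of t]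
      by (simp add: cvec.scale_left_distrib sum.distrib add_diff_add)
    with C(2) D(2) show "f + g \<in> ?G"
      by (auto intro!: exI[of _ "\<lambda>t e. C t e + D t e"])
  next
    fix c f assume "f \<in> ?G"
    then obtain C where C: "\<forall>t. f - (\<Sum>e\<in>B. cscale (C t e) (mon e)) \<in> K t"
        "\<forall>e\<in>B. isCont (\<lambda>t. C t e) 0"
      by auto
    have "cscale c f - (\<Sum>e\<in>B. cscale (c * C t e) (mon e)) \<in> K t" for t
      using ideal_cscale[OF K_ideal C(1)[rule_format], of c t]
      by (simp add: cvec.scale_right_diff_distrib cvec.scale_sum_right)
    with C(2) show "cscale c f \<in> ?G"
      by (auto intro!: exI[of _ "\<lambda>t e. c * C t e"])
  qed
  have G_mon: "mon e \<in> ?G" for e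
  proof -
    consider "e \<in> B" | "e = e0" | "wt e \<ge> 4"
      using B(4) by (fastforce simp: low_def)
    then show ?thesis
    proof cases
      case 1
      have "(\<Sum>e'\<in>B. cscale (if e' = e then 1 else 0) (mon e')) = (\<Sum>e'\<in>B. if e' = e then mon e' else 0)"
        by (rule sum.cong) auto
      with 1 B(1) have "(\<Sum>e'\<in>B. cscale (if e' = e then 1 else 0) (mon e')) = mon e"
        by simp
      then show ?thesis
        using ideal.subspace_0[OF K_ideal]
        by (auto intro!: exI[of _ "\<lambda>t e'. if e' = e then 1 else 0"])
    next
      case 2
      \<comment> \<open>On the scaled points the equation of the surface reads: the sum of
        \<open>V e * t^(3 - wt e) * mon e\<close> over \<open>low\<close> is zero. Solving for
        \<open>mon e0\<close> gives these coefficients.\<close>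
      define C where "C t e' = - (V e' / V e0) * t ^ (3 - wt e')" for t e'
      have "mon e0 - (\<Sum>e'\<in>B. cscale (C t e') (mon e')) \<in> K t" for t
      proof (cases "t = 0")
        case True
        \<comment> \<open>Since \<open>0 ^ 0 = 1\<close>, exactly the terms of weight 3 survive at
          \<open>t = 0\<close>, and the difference becomes the leading form divided by
          \<open>V e0\<close>.\<close>
        have "cscale (C 0 e') (mon e') = (if wt e' = 3 then - cscale (1 / V e0) (cscale (V e') (mon e')) else 0)"
          if "e' \<in> B" for e'
          using that B(5) by (auto simp: C_def low_def power_0_left)
        then have "(\<Sum>e'\<in>B. cscale (C 0 e') (mon e')) =
            (\<Sum>e'\<in>{e'\<in>B. wt e' = 3}. - cscale (1 / V e0) (cscale (V e') (mon e')))"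
          unfolding sum.inter_filter[OF B(1)] by (rule sum.cong[OF refl])
        moreover have "{e\<in>low. wt e = 3} = insert e0 {e'\<in>B. wt e' = 3}"
          using B(4) e0 by auto
        ultimately have "cscale (1 / V e0) (\<Sum>e\<in>{e\<in>low. wt e = 3}. cscale (V e) (mon e)) =
            mon e0 - (\<Sum>e'\<in>B. cscale (C 0 e') (mon e'))"
          using B(1,3) e0(3) by (simp add: cvec.scale_right_distrib cvec.scale_sum_right sum_negf)
        with True ideal_cscale[OF ideal v, of "1 / V e0"] show ?thesis
          by (simp add: K_def)
      next
        case False
        have "poly (\<Theta> q (mon e0 - (\<Sum>e'\<in>B. cscale (C t e') (mon e')))) t = 0" if "q \<in> Q" for q
        proof -
          have "V e0 * monom_at q e0 + (\<Sum>e\<in>B. V e * monom_at q e) = 0"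
            using that Q(1) unfolding S_def sum_low_B by auto
          then have eq: "(\<Sum>e\<in>B. V e * monom_at q e) = - (V e0 * monom_at q e0)"
            by (simp add: eq_neg_iff_add_eq_0 add.commute)
          have pw: "t ^ (3 - wt e') * t ^ wt e' = t ^ 3" if "e' \<in> B" for e'
            using that B(5) by (auto simp: low_def simp flip: power_add)
          have "C t e' * t ^ wt e' * monom_at q e' = - (t ^ 3 / V e0) * (V e' * monom_at q e')"
            if "e' \<in> B" for e'
          proof -
            have "C t e' * t ^ wt e' * monom_at q e' =
                - (V e' / V e0) * (t ^ (3 - wt e') * t ^ wt e') * monom_at q e'"
              by (simp only: C_def mult.assoc)
            then show ?thesis
              unfolding pw[OF that] by simp
          qed
          then have "(\<Sum>e'\<in>B. C t e' * t ^ wt e' * monom_at q e') =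
              - (t ^ 3 / V e0) * (\<Sum>e'\<in>B. V e' * monom_at q e')"
            unfolding sum_distrib_left by (rule sum.cong[OF refl])
          also have "\<dots> = monom_at q e0 * t ^ 3"
            unfolding eq using e0(3) by simp
          finally show ?thesis
            by (simp add: \<Theta>_diff \<Theta>_mon poly_monom eval_sum_mon e0(2))
        qed
        with False show ?thesis by (simp add: K_def)
      qed
      moreover have "isCont (\<lambda>t. C t e') 0" for e'
        unfolding C_def by (intro continuous_intros)
      ultimately show ?thesis
        unfolding 2 by (intro CollectI exI[of _ C]) auto
    next
      case 3
      obtain p where p: "\<And>q. q \<in> Q \<Longrightarrow> (\<Sum>e'\<in>B. p e' * monom_at q e') = monom_at q e"
        using interp[of "\<lambda>q. monom_at q e"] by blast
      \<comment> \<open>Interpolating on \<open>Q\<close> and rescaling produces the power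
        \<open>wt e - wt e'\<close>. It is positive, so the coordinates tend to 0, in accordance
        with \<open>mon e\<close> lying in \<open>I\<close>.\<close>
      define C where "C t e' = p e' * t ^ (wt e - wt e')" for t e'
      have lt: "wt e' < wt e" if "e' \<in> B" for e'
        using that 3 B(5) by (auto simp: low_def)
      have "mon e - (\<Sum>e'\<in>B. cscale (C t e') (mon e')) \<in> K t" for t
      proof (cases "t = 0")
        case True
        have "(\<Sum>e'\<in>B. cscale (C 0 e') (mon e')) = 0"
        proof (intro sum.neutral ballI)
          fix e' assume "e' \<in> B"
          from lt[OF this] show "cscale (C 0 e') (mon e') = 0" by (simp add: C_def power_0_left)
        qed
        with True high[OF 3] show ?thesis by (simp add: K_def)
      next
        case False
        have "poly (\<Theta> q (mon e - (\<Sum>e'\<in>B. cscale (C t e') (mon e')))) t = 0" if "q \<in> Q" for q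
        proof -
          have "C t e' * t ^ wt e' * monom_at q e' = p e' * monom_at q e' * t ^ wt e"
            if "e' \<in> B" for e'
          proof -
            have "t ^ (wt e - wt e') * t ^ wt e' = t ^ wt e"
              using lt[OF that] by (simp flip: power_add)
            moreover have "C t e' * t ^ wt e' * monom_at q e' =
                p e' * monom_at q e' * (t ^ (wt e - wt e') * t ^ wt e')"
              by (simp only: C_def ac_simps)
            ultimately show ?thesis by simp
          qed
          then have "(\<Sum>e'\<in>B. C t e' * t ^ wt e' * monom_at q e') =
              (\<Sum>e'\<in>B. p e' * monom_at q e') * t ^ wt e"
            unfolding sum_distrib_right by (rule sum.cong[OF refl])
          with p[OF that] show ?thesis
            by (simp add: \<Theta>_diff \<Theta>_mon poly_monom eval_sum_mon)
        qed
        with False show ?thesis by (simp add: K_def)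
      qed
      moreover have "isCont (\<lambda>t. C t e') 0" for e'
        unfolding C_def by (intro continuous_intros)
      ultimately show ?thesis
        by (intro CollectI exI[of _ C]) auto
    qed
  qed
  have G: "f \<in> ?G" for f
  proof -
    have "cvec.span (range mon) \<subseteq> ?G"
      using G_mon by (intro cvec.span_minimal G_subspace) blast
    then show ?thesis unfolding span_cmon by blast
  qed
  obtain en where en: "bij_betw en {..<12::nat} B"
    using ex_bij_betw_nat_finite[OF B(1)] B(2) by (auto simp: atLeast0LessThan)
  have sum_en: "(\<Sum>i<12. h (en i)) = (\<Sum>e\<in>B. h e)" for h :: "exponent \<Rightarrow> 'v cpoly"
    using en by (rule sum.reindex_bij_betw)
  have enB: "en i \<in> B" if "i < 12" for i
    using en that by (auto simp: bij_betw_def)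
  interpret path: ideal_path K 12 "\<lambda>i. mon (en i)"
  proof
    show "ideal.subspace (K t)" for t by (rule K_ideal)
  next
    fix f
    obtain C where "\<forall>t. f - (\<Sum>e\<in>B. cscale (C t e) (mon e)) \<in> K t"
        "\<forall>e\<in>B. isCont (\<lambda>t. C t e) 0"
      using G[of f] by auto
    then show "\<exists>C. (\<forall>t. f - (\<Sum>i<12. cscale (C t i) (mon (en i))) \<in> K t) \<and>
        (\<forall>i<12. isCont (\<lambda>t. C t i) 0)"
      using enB by (intro exI[of _ "\<lambda>t i. C t (en i)"]) (simp add: sum_en[of "\<lambda>e. cscale (C _ e) (mon e)"])
  next
    fix c t and i :: nat
    assume c: "(\<Sum>i<12. cscale (c i) (mon (en i))) \<in> K t" and i: "i < 12"
    define c' where "c' e = c (inv_into {..<12} en e)" for e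
    have c': "c' (en i) = c i" if "i < 12" for i
      using that en by (simp add: c'_def bij_betw_def)
    have "(\<Sum>i<12. cscale (c i) (mon (en i))) = (\<Sum>i<12. cscale (c' (en i)) (mon (en i)))"
      by (rule sum.cong) (auto simp: c')
    with c have "(\<Sum>e\<in>B. cscale (c' e) (mon e)) \<in> K t"
      unfolding sum_en[of "\<lambda>e. cscale (c' e) (mon e)"] by simp
    from K_indep[OF this] enB[OF i] c'[OF i] show "c i = 0" by auto
  qed
  have "K t \<in> {I \<in> Hilb 12. radical_ideal I}" if "t \<noteq> 0" for t
  proof -
    \<comment> \<open>Values at points lie in a field, so a power vanishes only if its base does;
      the exponent 0 is no exception because the value 1 is nonzero.\<close>
    have "f \<in> K t" if "f ^ n \<in> K t" for f n
    proof -
      have "Q \<noteq> {}" using Q by auto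
      then show ?thesis
        using that \<open>t \<noteq> 0\<close> by (auto simp: K_def \<Theta>_power)
    qed
    then show ?thesis
      using path.in_Hilb K_ideal by (auto simp: radical_ideal_def)
  qed
  then have "K 0 \<in> smoothable_component 12"
    unfolding smoothable_component_def by (rule path.in_closure)
  moreover have "K 0 \<in> Hilb 12"
    by (rule path.in_Hilb)
  ultimately show ?thesis
    by (simp add: K_def)
qed

end

section \<open>The given ideal and the weight filtration\<close>

lemma ideal_set_plus:
  assumes "ideal.subspace S" "ideal.subspace T"
  shows "ideal.subspace (S + T)"
proof (rule ideal.subspaceI)
  show "0 \<in> S + T"
    using set_plus_intro[OF assms[THEN ideal.subspace_0]] by simp
next
  fix x y assume "x \<in> S + T" "y \<in> S + T"
  then obtain x1 x2 y1 y2 where "x = x1 + x2" "y = y1 + y2" "x1 \<in> S" "x2 \<in> T" "y1 \<in> S" "y2 \<in> T"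
    by (auto elim!: set_plus_elim)
  then have "(x1 + y1) + (x2 + y2) \<in> S + T"
    by (intro set_plus_intro ideal.subspace_add assms)
  with \<open>x = x1 + x2\<close> \<open>y = y1 + y2\<close> show "x + y \<in> S + T"
    by (simp add: add.assoc add.left_commute)
next
  fix c x assume "x \<in> S + T"
  then obtain x1 x2 where "x = x1 + x2" "x1 \<in> S" "x2 \<in> T"
    by (auto elim!: set_plus_elim)
  then have "c * x1 + c * x2 \<in> S + T"
    by (intro set_plus_intro ideal.subspace_scale assms)
  with \<open>x = x1 + x2\<close> show "c * x \<in> S + T"
    by (simp add: distrib_left)
qed

lemma set_plus_ideal_left:
  assumes "x \<in> S" "ideal.subspace T"
  shows "x \<in> S + T"
  using set_plus_intro[OF assms(1) ideal.subspace_0[OF assms(2)]] by simp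

lemma set_plus_ideal_right:
  assumes "ideal.subspace S" "x \<in> T"
  shows "x \<in> S + T"
  using set_plus_intro[OF ideal.subspace_0[OF assms(1)] assms(2)] by simp

lemma ideal_prod_ideal: "ideal.subspace (ideal_prod S T)"
  unfolding ideal_prod_def by (rule ideal.subspace_span)

lemma ideal_prod_mem: "x \<in> S \<Longrightarrow> y \<in> T \<Longrightarrow> x * y \<in> ideal_prod S T"
  unfolding ideal_prod_def by (rule ideal.span_base) blast

lemma linear_form_irrelevant:
  assumes "u \<in> cvec.span (range cvar)"
  shows "u \<in> irrelevant_ideal"
  using assms
proof (induction rule: cvec.span_induct_alt)
  case base
  show ?case unfolding irrelevant_ideal_def by (rule ideal.span_zero)
next
  case (step c x y)
  then show ?case
    unfolding irrelevant_ideal_def cscale_def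
    by (auto intro: ideal.span_add ideal.span_scale ideal.span_base)
qed

context weighted_coords
begin

text \<open>The weight filtration, tested on curves: the restriction of \<open>f\<close> to every
  weighted curve vanishes to order at least \<open>m\<close> at \<open>s = 0\<close>.\<close>

definition order_ge :: "nat \<Rightarrow> 'v cpoly \<Rightarrow> bool"
  where "order_ge m f \<longleftrightarrow> (\<forall>q. \<forall>n<m. coeff (\<Theta> q f) n = 0)"

lemma order_geD: "order_ge m f \<Longrightarrow> n < m \<Longrightarrow> coeff (\<Theta> q f) n = 0"
  unfolding order_ge_def by blast

text \<open>In the Cauchy product for a coefficient below \<open>m + m'\<close>, one of the two
  indices lies below its bound.\<close>

lemma order_ge_mult:
  assumes "order_ge m f" "order_ge m' g"
  shows "order_ge (m + m') (f * g)"
  unfolding order_ge_def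
proof (intro allI impI)
  fix q n assume n: "n < m + m'"
  have zero: "coeff (\<Theta> q f) i * coeff (\<Theta> q g) (n - i) = 0" if "i \<le> n" for i
  proof (cases "i < m")
    case True
    then show ?thesis using order_geD[OF assms(1)] by simp
  next
    case False
    with n that have "n - i < m'" by linarith
    then show ?thesis using order_geD[OF assms(2)] by simp
  qed
  show "coeff (\<Theta> q (f * g)) n = 0"
    unfolding \<Theta>_mult coeff_mult by (intro sum.neutral ballI zero) simp
qed

lemma order_ge_ideal: "ideal.subspace {f. order_ge m f}"
proof (rule ideal.subspaceI)
  fix c f assume "f \<in> {f. order_ge m f}"
  moreover have "order_ge 0 c" by (simp add: order_ge_def)
  ultimately have "order_ge (0 + m) (c * f)"
    by (intro order_ge_mult) simp_all
  then show "c * f \<in> {f. order_ge m f}" by simp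
qed (auto simp: order_ge_def \<Theta>_0 \<Theta>_add)

lemma order_ge_ideal_prod:
  assumes "\<And>f. f \<in> S \<Longrightarrow> order_ge m f" "\<And>f. f \<in> T \<Longrightarrow> order_ge m' f" "f \<in> ideal_prod S T"
  shows "order_ge (m + m') f"
proof -
  have "ideal_prod S T \<subseteq> {f. order_ge (m + m') f}"
    unfolding ideal_prod_def
    by (rule ideal.span_minimal[OF _ order_ge_ideal]) (use assms(1,2) in \<open>auto intro: order_ge_mult\<close>)
  with assms(3) show ?thesis by blast
qed

lemma order_ge_cvar: "order_ge 1 (cvar i)"
proof -
  have "cvar i \<in> cvec.span {l, a, b}"
    using vars by blast
  then show ?thesis
  proof (induction rule: cvec.span_induct_alt)
    case base
    show ?case by (simp add: order_ge_def \<Theta>_0)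
  next
    case (step c x y)
    then have "coeff (\<Theta> q x) 0 = 0" for q
      by (cases q) (auto simp: \<Theta>_l \<Theta>_a \<Theta>_b)
    with step show ?case
      by (simp add: order_ge_def \<Theta>_add \<Theta>_cscale)
  qed
qed

lemma order_ge_l: "order_ge 2 l"
  by (auto simp: order_ge_def \<Theta>_l)

lemma order_ge_irrelevant:
  assumes "f \<in> irrelevant_ideal"
  shows "order_ge 1 f"
proof -
  have "irrelevant_ideal \<subseteq> {f. order_ge 1 f}"
    unfolding irrelevant_ideal_def
    by (rule ideal.span_minimal[OF _ order_ge_ideal]) (use order_ge_cvar in blast)
  with assms show ?thesis by blast
qed

definition J :: "'v cpoly set"
  where "J = ideal.span {l} + ideal_prod irrelevant_ideal irrelevant_ideal"

lemma J_ideal: "ideal.subspace J"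
  unfolding J_def by (intro ideal_set_plus ideal.subspace_span ideal_prod_ideal)

lemma order_ge_J:
  assumes "f \<in> J"
  shows "order_ge 2 f"
proof -
  obtain g h where f: "f = g + h" and g: "g \<in> ideal.span {l}"
    and h: "h \<in> ideal_prod irrelevant_ideal irrelevant_ideal"
    using assms unfolding J_def by (rule set_plus_elim)
  have "ideal.span {l} \<subseteq> {f. order_ge 2 f}"
    by (rule ideal.span_minimal[OF _ order_ge_ideal]) (simp add: order_ge_l)
  then have "g \<in> {f. order_ge 2 f}" using g by blast
  moreover have "order_ge (1 + 1) h"
    using order_ge_irrelevant order_ge_irrelevant h by (rule order_ge_ideal_prod)
  then have "h \<in> {f. order_ge 2 f}" by (simp add: numeral_2_eq_2)
  ultimately have "f \<in> {f. order_ge 2 f}"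
    unfolding f by (rule ideal.subspace_add[OF order_ge_ideal])
  then show ?thesis by simp
qed

lemma l_in_J: "l \<in> J"
  unfolding J_def by (intro set_plus_ideal_left ideal.span_base ideal_prod_ideal) simp

lemma forms_prod_in_J: "u \<in> {l, a, b} \<Longrightarrow> u' \<in> {l, a, b} \<Longrightarrow> u * u' \<in> J"
  unfolding J_def using forms
  by (intro set_plus_ideal_right ideal_prod_mem linear_form_irrelevant ideal.subspace_span) blast+

lemma cmon_mult: "mon (i, j, k) * mon (i', j', k') = mon (i + i', j + j', k + k')"
  by (simp only: cmon.simps power_add ac_simps)

text \<open>A monomial of weight at least 2 is divisible by \<open>l\<close>, \<open>a^2\<close>,
  \<open>a b\<close> or \<open>b^2\<close>.\<close>

lemma mon_in_J:
  assumes "wt e \<ge> 2"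
  shows "mon e \<in> J"
proof -
  obtain i j k where e: "e = (i, j, k)" by (cases e)
  consider "i \<ge> 1" | "j \<ge> 2" | "j \<ge> 1" "k \<ge> 1" | "k \<ge> 2"
    using assms e by (simp) linarith
  then obtain i1 j1 k1 i2 j2 k2 where "mon (i1, j1, k1) \<in> J"
    "i = i1 + i2" "j = j1 + j2" "k = k1 + k2"
  proof cases
    case 1
    show ?thesis by (rule that[of 1 0 0 "i - 1" j k]) (use 1 l_in_J in simp_all)
  next
    case 2
    show ?thesis by (rule that[of 0 2 0 i "j - 2" k])
      (use 2 forms_prod_in_J[of a a] in \<open>simp_all add: power2_eq_square\<close>)
  next
    case 3
    show ?thesis by (rule that[of 0 1 1 i "j - 1" "k - 1"])
      (use 3 forms_prod_in_J[of a b] in simp_all)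
  next
    case 4
    show ?thesis by (rule that[of 0 0 2 i j "k - 2"])
      (use 4 forms_prod_in_J[of b b] in \<open>simp_all add: power2_eq_square\<close>)
  qed
  then have "mon e = mon (i2, j2, k2) * mon (i1, j1, k1)" and J: "mon (i1, j1, k1) \<in> J"
    unfolding e cmon_mult by (simp_all only: add.commute)
  then show ?thesis
    using ideal.subspace_scale[OF J_ideal J] by simp
qed

text \<open>A factor of weight exactly 2 can always be split off: \<open>l\<close> if it occurs,
  otherwise a quadratic monomial in \<open>a\<close> and \<open>b\<close>. The cofactor has weight
  at least 2.\<close>

lemma mon_in_J2:
  assumes "wt e \<ge> 4"
  shows "mon e \<in> ideal_prod J J"
proof -
  obtain i j k where e: "e = (i, j, k)" by (cases e)
  consider "i \<ge> 1" | "i = 0" "j \<ge> 2" | "i = 0" "j \<le> 1"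
    by linarith
  then obtain i1 j1 k1 i2 j2 k2 where "wt (i1, j1, k1) \<ge> 2" "wt (i2, j2, k2) \<ge> 2"
    "i = i1 + i2" "j = j1 + j2" "k = k1 + k2"
  proof cases
    case 1
    show ?thesis by (rule that[of 1 0 0 "i - 1" j k]) (use 1 assms e in auto)
  next
    case 2
    show ?thesis by (rule that[of 0 2 0 0 "j - 2" k]) (use 2 assms e in auto)
  next
    case 3
    show ?thesis by (rule that[of 0 j "2 - j" 0 0 "k - (2 - j)"]) (use 3 assms e in auto)
  qed
  then have "mon e = mon (i1, j1, k1) * mon (i2, j2, k2)"
    and "mon (i1, j1, k1) \<in> J" "mon (i2, j2, k2) \<in> J"
    unfolding e cmon_mult by (simp_all only: mon_in_J)
  then show ?thesis
    by (simp only: ideal_prod_mem)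
qed

text \<open>Elements of the square of \<open>J\<close> have order at least 4. In a multiple
  \<open>u * v\<close> only the constant term of \<open>u\<close> contributes up to weight 3,
  because \<open>v\<close> is homogeneous of weight 3. Hence the parts of weight at most 3 of
  elements of \<open>I\<close> come from scalar multiples of \<open>v\<close>.\<close>

lemma smoothable_J2:
  assumes e0: "e0 \<in> low" "wt e0 = 3" "V e0 \<noteq> 0"
    and surface: "\<And>p. vanishes_on_surface V p \<Longrightarrow> p e0 = 0 \<Longrightarrow> \<forall>e\<in>low. p e = 0"
    and v: "v = (\<Sum>e\<in>{e\<in>low. wt e = 3}. cscale (V e) (mon e))"
    and I: "I = ideal_prod J J + ideal.span {v}"
  shows "I \<in> Hilb 12 \<and> I \<in> smoothable_component 12"
proof (rule smoothable_initial[of I e0 V])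
  show "ideal.subspace I"
    unfolding I by (intro ideal_set_plus ideal_prod_ideal ideal.subspace_span)
  show "(\<Sum>e\<in>{e\<in>low. wt e = 3}. cscale (V e) (mon e)) \<in> I"
    unfolding v[symmetric] I by (intro set_plus_ideal_right ideal_prod_ideal ideal.span_base) simp
  show "mon e \<in> I" if "wt e \<ge> 4" for e
    unfolding I by (intro set_plus_ideal_left mon_in_J2 that ideal.subspace_span)
next
  fix f assume "f \<in> I"
  then obtain g h where f: "f = g + h" and g: "g \<in> ideal_prod J J" and h: "h \<in> ideal.span {v}"
    unfolding I by (rule set_plus_elim)
  from h obtain u where u: "h = u * v"
    unfolding ideal.span_singleton by blast
  obtain k where k: "\<And>q. coeff (\<Theta> q u) 0 = k"
    using constant_coeff by blast
  have fin: "finite {e\<in>low. wt e = 3}"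
    using finite_low by simp
  have "order_ge (2 + 2) g"
    using order_ge_J order_ge_J g by (rule order_ge_ideal_prod)
  then have g0: "coeff (\<Theta> q g) n = 0" if "n \<le> 3" for q n
    using that by (intro order_geD) auto
  have cv: "coeff (\<Theta> q v) n = (if n = 3 then \<Sum>e\<in>{e\<in>low. wt e = 3}. V e * monom_at q e else 0)" for q n
  proof -
    have "{e \<in> {e\<in>low. wt e = 3}. wt e = n} = (if n = 3 then {e\<in>low. wt e = 3} else {})"
      by auto
    then show ?thesis
      unfolding v coeff_sum_mon[OF fin] by simp
  qed
  have "coeff (\<Theta> q f) n = (if n = 3 then k * (\<Sum>e\<in>{e\<in>low. wt e = 3}. V e * monom_at q e) else 0)"
    if n: "n \<le> 3" for q n
  proof -
    have "coeff (\<Theta> q f) n = (\<Sum>i\<le>n. coeff (\<Theta> q u) i * coeff (\<Theta> q v) (n - i))"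
      by (simp add: f u \<Theta>_add \<Theta>_mult g0[OF n] coeff_mult)
    also have "\<dots> = (\<Sum>i\<le>n. if i = 0 then k * coeff (\<Theta> q v) n else 0)"
      by (rule sum.cong) (use n in \<open>auto simp: k cv\<close>)
    also have "\<dots> = k * coeff (\<Theta> q v) n"
      by simp
    finally show ?thesis
      by (simp add: cv)
  qed
  then show "\<exists>k. \<forall>q. \<forall>n\<le>3. coeff (\<Theta> q f) n =
      (if n = 3 then k * (\<Sum>e\<in>{e\<in>low. wt e = 3}. V e * monom_at q e) else 0)"
    by blast
qed (use e0 surface in blast)+

end

section \<open>Construction of weighted coordinates and normal forms\<close>

lemma vector_space_pair_cscale_smult:
  "vector_space_pair (cscale :: complex \<Rightarrow> 'v cpoly \<Rightarrow> 'v cpoly)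
    (Polynomial.smult :: complex \<Rightarrow> complex poly \<Rightarrow> complex poly)"
proof (rule vector_space_pair.intro)
  show "vector_space (cscale :: complex \<Rightarrow> 'v cpoly \<Rightarrow> 'v cpoly)"
    by (rule cvec.vector_space_axioms)
  show "vector_space (Polynomial.smult :: complex \<Rightarrow> complex poly \<Rightarrow> complex poly)"
    by unfold_locales (simp_all add: smult_add_right smult_add_left)
qed

text \<open>Prescribing values on the basis \<open>l\<close>, \<open>a\<close>, \<open>b\<close> of
  the linear forms gives a linear map; its values on the variables define a substitution
  homomorphism. By linearity the two agree on all linear forms.\<close>

lemma weighted_coords_exist:
  fixes l a b :: "'v::finite cpoly"
  assumes indep: "cvec.independent {l, a, b}" and dist: "a \<noteq> l" "b \<noteq> l" "b \<noteq> a"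
    and forms: "{l, a, b} \<subseteq> cvec.span (range cvar)"
    and vars: "range cvar \<subseteq> cvec.span {l, a, b}"
  obtains \<Theta> where "weighted_coords l a b \<Theta>"
proof -
  define F where "F = (\<lambda>(X, Y, Z) x. if x = l then Polynomial.monom X 2
    else if x = a then Polynomial.monom Y 1 else Polynomial.monom (Z::complex) 1)"
  have "\<forall>q. \<exists>g. Vector_Spaces.linear cscale Polynomial.smult g \<and> (\<forall>x\<in>{l, a, b}. g x = F q x)"
    using vector_space_pair.linear_independent_extend[OF vector_space_pair_cscale_smult indep]
    by blast
  from choice[OF this] obtain g where
    lin: "\<And>q. Vector_Spaces.linear cscale Polynomial.smult (g q)" and
    g: "\<And>q x. x \<in> {l, a, b} \<Longrightarrow> g q x = F q x"
    by auto
  define \<Theta> where "\<Theta> q = csubst (\<lambda>i. g q (cvar i))" for q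
  have \<Theta>: "\<Theta> q f = g q f" if "f \<in> cvec.span (range cvar)" for q f
    using that
  proof (induction rule: cvec.span_induct_alt)
    case base
    have "g q 0 = 0"
      using module_hom.zero[OF Vector_Spaces.linear.axioms(3)[OF lin]] .
    then show ?case by (simp add: \<Theta>_def csubst_0)
  next
    case (step c x y)
    note hom = Vector_Spaces.linear.axioms(3)[OF lin, of q]
    from step obtain i where "x = cvar i" by blast
    with step.IH show ?case
      by (simp add: \<Theta>_def csubst_add csubst_cscale csubst_cvar module_hom.add[OF hom]
          module_hom.scale[OF hom])
  qed
  have "weighted_coords l a b \<Theta>"
  proof
    show "\<Theta> (X, Y, Z) l = Polynomial.monom X 2" "\<Theta> (X, Y, Z) a = Polynomial.monom Y 1"
      "\<Theta> (X, Y, Z) b = Polynomial.monom Z 1" for X Y Z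
      using forms dist by (simp_all add: \<Theta> g F_def)
    show "{l, a, b} \<subseteq> cvec.span (range cvar)" "range cvar \<subseteq> cvec.span {l, a, b}"
      by (rule forms vars)+
  qed (simp_all add: \<Theta>_def csubst_add csubst_mult csubst_cscale csubst_1)
  then show thesis by (rule that)
qed

lemma cvar_homogeneous: "cvar i \<in> homogeneous 1"
  by (simp add: homogeneous_def cvar_def lookup_single when_def)

lemma homogeneous_1_span: "(homogeneous 1 :: 'v::finite cpoly set) \<subseteq> cvec.span (range cvar)"
proof
  fix p :: "'v cpoly" assume p: "p \<in> homogeneous 1"
  have "Poly_Mapping.single m (Poly_Mapping.lookup p m) \<in> cvec.span (range cvar)"
    if "m \<in> Poly_Mapping.keys p" for m
  proof -
    have "(\<Sum>i\<in>UNIV. Poly_Mapping.lookup m i) = 1"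
      using p that by (simp add: homogeneous_def)
    then obtain i where i: "Poly_Mapping.lookup m i = 1" "\<And>j. j \<noteq> i \<Longrightarrow> Poly_Mapping.lookup m j = 0"
      using sum_eq_1_iff[of UNIV "Poly_Mapping.lookup m"] by auto
    then have "m = Poly_Mapping.single i 1"
      by (intro poly_mapping_eqI) (auto simp: lookup_single when_def)
    then have "Poly_Mapping.single m (Poly_Mapping.lookup p m) = cscale (Poly_Mapping.lookup p m) (cvar i)"
      by (simp add: cscale_def cconst_def cvar_def mult_single)
    then show ?thesis
      by (simp add: cvec.span_scale cvec.span_base)
  qed
  then show "p \<in> cvec.span (range cvar)"
    by (subst cpoly_sum_monomials) (rule cvec.span_sum)
qed

text \<open>A nonzero \<open>u\<close> is taken as the first basis vector, so that
  \<open>l * u\<close> becomes the monomial \<open>l * a\<close>.\<close>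

lemma plane_basis:
  assumes L: "cvec.dim L = 2" and u: "u \<in> L"
  obtains a b where "a \<noteq> b" "cvec.independent {a, b}" "{a, b} \<subseteq> L" "L \<subseteq> cvec.span {a, b}"
    "u \<noteq> 0 \<Longrightarrow> a = u"
proof -
  \<comment> \<open>The set \<open>{0}\<close> would be dependent, so a zero \<open>u\<close> is
    left out.\<close>
  define S where "S = (if u = 0 then {} else {u})"
  have "S \<subseteq> L" "cvec.independent S"
    using u cvec.independent_empty by (auto simp: S_def)
  then obtain B where B: "S \<subseteq> B" "B \<subseteq> L" "cvec.independent B" "L \<subseteq> cvec.span B"
    by (rule cvec.maximal_independent_subset_extend)
  then have "card B = 2"
    using L cvec.basis_card_eq_dim by metis
  then obtain x y where xy: "B = {x, y}" "x \<noteq> y"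
    by (auto simp: card_2_iff)
  show thesis
  proof (cases "u \<noteq> 0 \<and> y = u")
    case True
    then show thesis
      using B xy by (intro that[of y x]) (auto simp: insert_commute)
  next
    case False
    then show thesis
      using B xy by (intro that[of x y]) (auto simp: S_def)
  qed
qed

lemma span_pair:
  assumes "x \<in> cvec.span {a, b}"
  obtains p q where "x = cscale p a + cscale q b"
proof -
  obtain p where "x - cscale p a \<in> cvec.span {b}"
    using assms cvec.span_breakdown_eq by blast
  then obtain q where "x - cscale p a = cscale q b"
    unfolding cvec.span_singleton by blast
  then have "x = cscale p a + cscale q b"
    by (simp add: diff_eq_eq add.commute)
  then show thesis by (rule that)
qed

lemma cconst_add: "cconst (x + y) = cconst x + cconst y"
  by (simp add: cconst_def single_add)

lemma cconst_mult: "cconst (x * y) = cconst x * cconst y"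
  by (simp add: cconst_def mult_single)

text \<open>The coefficients are ring elements, so that the identity applies to the constants
  \<open>cconst c\<close> once \<open>cscale\<close> is unfolded.\<close>

lemma binary_cubic_expand:
  fixes a b :: "'a::comm_ring_1"
  shows "c * ((f1 * a + f2 * b) * (g1 * a + g2 * b) * (h1 * a + h2 * b))
      + (c0 * b ^ 3 + c1 * (a * b ^ 2) + c2 * (a ^ 2 * b) + c3 * a ^ 3)
    = (c0 + c * (f2 * g2 * h2)) * b ^ 3
      + (c1 + c * (f1 * g2 * h2 + f2 * g1 * h2 + f2 * g2 * h1)) * (a * b ^ 2)
      + (c2 + c * (f1 * g1 * h2 + f1 * g2 * h1 + f2 * g1 * h1)) * (a ^ 2 * b)
      + (c3 + c * (f1 * g1 * h1)) * a ^ 3"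
  by (simp only: distrib_left distrib_right power2_eq_square power3_eq_cube ac_simps)

lemma Sym3_binary_cubic:
  assumes L: "L \<subseteq> cvec.span {a, b}" and s: "s \<in> Sym3 L"
  obtains c0 c1 c2 c3 where
    "s = cscale c0 (b ^ 3) + cscale c1 (a * b ^ 2) + cscale c2 (a ^ 2 * b) + cscale c3 (a ^ 3)"
proof -
  have "\<exists>c0 c1 c2 c3. s = cscale c0 (b ^ 3) + cscale c1 (a * b ^ 2) + cscale c2 (a ^ 2 * b) + cscale c3 (a ^ 3)"
    using s unfolding Sym3_def
  proof (induction rule: cvec.span_induct_alt)
    case base
    have "0 = cscale 0 (b ^ 3) + cscale 0 (a * b ^ 2) + cscale 0 (a ^ 2 * b) + cscale 0 (a ^ 3)"
      by simp
    then show ?case by blast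
  next
    case (step c x y)
    then obtain f g h where x: "x = f * g * h" and fgh: "f \<in> L" "g \<in> L" "h \<in> L"
      by blast
    obtain f1 f2 where f: "f = cscale f1 a + cscale f2 b" using L fgh(1) span_pair by blast
    obtain g1 g2 where g: "g = cscale g1 a + cscale g2 b" using L fgh(2) span_pair by blast
    obtain h1 h2 where h: "h = cscale h1 a + cscale h2 b" using L fgh(3) span_pair by blast
    from step.IH obtain c0 c1 c2 c3 where
      y: "y = cscale c0 (b ^ 3) + cscale c1 (a * b ^ 2) + cscale c2 (a ^ 2 * b) + cscale c3 (a ^ 3)"
      by blast
    have "cscale c x + y = cscale (c0 + c * (f2 * g2 * h2)) (b ^ 3)
      + cscale (c1 + c * (f1 * g2 * h2 + f2 * g1 * h2 + f2 * g2 * h1)) (a * b ^ 2)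
      + cscale (c2 + c * (f1 * g1 * h2 + f1 * g2 * h1 + f2 * g1 * h1)) (a ^ 2 * b)
      + cscale (c3 + c * (f1 * g1 * h1)) (a ^ 3)"
      unfolding x f g h y cscale_def cconst_add cconst_mult by (rule binary_cubic_expand)
    then show ?case by blast
  qed
  with that show thesis by blast
qed

lemma low_weight_3: "{e\<in>low. wt e = 3} = {(0,0,3), (0,1,2), (0,2,1), (0,3,0), (1,0,1), (1,1,0)}"
  by (auto simp: low_eq)

theorem proposition3p8:
  fixes l v :: "3 cpoly" and L I J :: "3 cpoly set"
  assumes "l \<in> homogeneous 1" and "l \<noteq> 0"
    and "cvec.subspace L" and "L \<subseteq> homogeneous 1" and "cvec.dim L = 2"
    and "homogeneous 1 = cvec.span {l} + L" and "cvec.span {l} \<inter> L = {0}"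
    and "v \<in> (Sym3 L + l *o L) - {0}"
    and "J = ideal.span {l} + ideal_prod irrelevant_ideal irrelevant_ideal"
    and "I = ideal_prod J J + ideal.span {v}"
  shows "I \<in> Hilb 12 \<and> I \<in> smoothable_component 12"
proof -
  from assms(8) have "v \<in> Sym3 L + l *o L" and v0: "v \<noteq> 0" by auto
  from this(1) obtain s u where v: "v = s + l * u" and s: "s \<in> Sym3 L" and u: "u \<in> L"
    by (rule set_plus_elim) (auto simp: elt_set_times_def)
  obtain a b where ab: "a \<noteq> b" "cvec.independent {a, b}" "{a, b} \<subseteq> L" "L \<subseteq> cvec.span {a, b}"
    and au: "u \<noteq> 0 \<Longrightarrow> a = u"
    using plane_basis[OF assms(5) u] by blast
  have "cvec.span {a, b} \<subseteq> L"
    using ab(3) assms(3) by (rule cvec.span_minimal)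
  moreover have lL: "l \<notin> L"
    using assms(2,7) cvec.span_base[of l "{l}"] by blast
  ultimately have "l \<notin> cvec.span {a, b}" by blast
  then have indep: "cvec.independent {l, a, b}"
    using ab(2) by (rule cvec.independent_insertI)
  have "{l, a, b} \<subseteq> homogeneous 1"
    using assms(1,4) ab(3) by blast
  then have forms: "{l, a, b} \<subseteq> cvec.span (range cvar)"
    using homogeneous_1_span by blast
  have vars: "range cvar \<subseteq> cvec.span {l, a, b}"
  proof
    fix x :: "3 cpoly" assume "x \<in> range cvar"
    then have "x \<in> cvec.span {l} + L"
      using cvar_homogeneous assms(6) by blast
    then obtain y z where x: "x = y + z" "y \<in> cvec.span {l}" "z \<in> L"
      by (rule set_plus_elim)
    then have "y \<in> cvec.span {l, a, b}" "z \<in> cvec.span {l, a, b}"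
      using ab(4) cvec.span_mono[of "{l}" "{l, a, b}"] cvec.span_mono[of "{a, b}" "{l, a, b}"] by auto
    then show "x \<in> cvec.span {l, a, b}"
      unfolding x by (rule cvec.span_add)
  qed
  obtain \<Theta> where "weighted_coords l a b \<Theta>"
    by (rule weighted_coords_exist[OF indep _ _ _ forms vars]) (use lL ab in auto)
  then interpret weighted_coords l a b \<Theta> .
  obtain c0 c1 c2 c3 where
    s_eq: "s = cscale c0 (b ^ 3) + cscale c1 (a * b ^ 2) + cscale c2 (a ^ 2 * b) + cscale c3 (a ^ 3)"
    using ab(4) s by (rule Sym3_binary_cubic)
  \<comment> \<open>The number \<open>k\<close> is the coefficient of \<open>l * a\<close>, and
    \<open>r\<close> is the exponent of the added lower term: \<open>V 1 (0,0,0)\<close> stands for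
    \<open>v + 1\<close> when \<open>u\<close> is nonzero, and \<open>V 0 (1,0,0)\<close> for
    \<open>v + l\<close> when \<open>u = 0\<close>.\<close>
  define V where "V k r = (\<lambda>e. 0)((0,0,3) := c0, (0,1,2) := c1, (0,2,1) := c2, (0,3,0) := c3,
    (1,1,0) := k, r := 1)" for k :: complex and r :: exponent
  have I: "I = ideal_prod local.J local.J + ideal.span {v}"
    unfolding J_def using assms(9,10) by simp
  show ?thesis
  proof (cases "u = 0")
    case False
    \<comment> \<open>Now \<open>a = u\<close>, so \<open>l * u\<close> is the monomial with
      exponent \<open>(1,1,0)\<close>, which also serves as \<open>e0\<close>.\<close>
    then have v_eq: "v = (\<Sum>e\<in>{e\<in>low. wt e = 3}. cscale (V 1 (0,0,0) e) (mon e))"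
      unfolding low_weight_3 v s_eq V_def using au by simp
    have surface: "\<forall>e\<in>low. p e = 0" if "vanishes_on_surface (V 1 (0,0,0)) p" "p (1,1,0) = 0" for p
      by (rule quadric_surface[OF _ _ _ _ _ _ _ _ _ that]) (simp_all add: V_def)
    have "(1,1,0) \<in> low" "wt (1,1,0) = 3" "V 1 (0,0,0) (1,1,0) \<noteq> 0"
      by (simp_all add: low_eq V_def)
    then show ?thesis
      using surface v_eq I by (rule smoothable_J2)
  next
    case True
    then have v_eq: "v = (\<Sum>e\<in>{e\<in>low. wt e = 3}. cscale (V 0 (1,0,0) e) (mon e))"
      unfolding low_weight_3 v s_eq V_def by simp
    \<comment> \<open>With \<open>u = 0\<close> the form \<open>v\<close> is a nonzero binary cubic,
      and any exponent with nonzero coefficient can serve as \<open>e0\<close>.\<close>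
    have "c0 \<noteq> 0 \<or> c1 \<noteq> 0 \<or> c2 \<noteq> 0 \<or> c3 \<noteq> 0"
      using True v v0 s_eq by auto
    then have "\<exists>e0\<in>{(0,0,3), (0,1,2), (0,2,1), (0,3,0)}. V 0 (1,0,0) e0 \<noteq> 0"
      by (simp add: V_def)
    then obtain e0 where e0: "e0 \<in> {(0,0,3), (0,1,2), (0,2,1), (0,3,0)}" "V 0 (1,0,0) e0 \<noteq> 0"
      by blast
    then have low: "e0 \<in> low" "wt e0 = 3"
      by (auto simp: low_eq)
    have surface: "\<forall>e\<in>low. p e = 0" if "vanishes_on_surface (V 0 (1,0,0)) p" "p e0 = 0" for p
      by (rule cubic_graph[OF _ _ _ _ _ _ _ _ _ e0 that]) (simp_all add: V_def)
    show ?thesis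
      using low e0(2) surface v_eq I by (rule smoothable_J2)
  qed
qed

end
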